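(* Let $I \subseteq \mathbb{R}$ be an open interval. Consider a curve of hyperbolic polynomials $$P(t)(x) = x^n + \sum_{j=1}^n (-1)^j a_j(t)\, x^{n-j},\qquad t\in I,$$ with definable $C^n$ coefficients $a_j:I\to\mathbb{R}$. Then the roots of $P$ can be parameterized globally by definable $C^1$ functions, i.e. there exist definable $C^1$ functions $\lambda_1,\dots,\lambda_n:I\to\mathbb{R}$ with $P(t)(x)=\prod_{j=1}^n(x-\lambda_j(t))$ for all $t\in I$.
   Context: A monic real polynomial is hyperbolic if all its roots are real. Fix an arbitrary o-minimal structure $\mathcal{M}$ on $(\mathbb{R},+,\cdot)$: families $\mathcal{M}_n$ of subsets of $\mathbb{R}^n$ ($n\ge 1$) closed under finite set-theoretical operations, products and coordinate projections, containing all sets $\{f=0, g_1>0,\dots,g_l>0\}$ with $f,g_i$ real polynomials, and such that $\mathcal{M}_1$ consists exactly of the finite unions of open intervals and points. A set is definable if it belongs to some $\mathcal{M}_n$; a map between subsets of Euclidean spaces is definable if its graph is definable. *)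

theory Defs
  imports "HOL-Analysis.Analysis" "HOL-Computational_Algebra.Polynomial"
begin

text \<open>
  Points of \<open>\<real>\<^sup>n\<close> are represented by real lists of length \<open>n\<close>, since the families
  of an o-minimal structure relate different dimensions.  In particular, the
  product of \<open>A\<close> and \<open>B\<close> consists of the concatenations \<open>x @ y\<close>.
\<close>

definition euclidean_lists :: "nat \<Rightarrow> real list set" where
  "euclidean_lists n = {x. length x = n}"

inductive real_poly_fun :: "nat \<Rightarrow> (real list \<Rightarrow> real) \<Rightarrow> bool" for n where
  const: "real_poly_fun n (\<lambda>x. c)"
| coord: "i < n \<Longrightarrow> real_poly_fun n (\<lambda>x. x ! i)"
| add: "real_poly_fun n f \<Longrightarrow> real_poly_fun n g \<Longrightarrow> real_poly_fun n (\<lambda>x. f x + g x)"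
| mult: "real_poly_fun n f \<Longrightarrow> real_poly_fun n g \<Longrightarrow> real_poly_fun n (\<lambda>x. f x * g x)"

text \<open>
  The coordinate projection selecting the coordinates with index in \<open>K\<close> is
  \<open>\<lambda>x. nths x K\<close>.  Open intervals may be unbounded.  Nothing is required of
  \<open>M 0\<close>.
\<close>

locale o_minimal_structure =
  fixes M :: "nat \<Rightarrow> real list set set"
  assumes in_space: "\<And>n A. 1 \<le> n \<Longrightarrow> A \<in> M n \<Longrightarrow> A \<subseteq> euclidean_lists n"
    and union: "\<And>n A B. 1 \<le> n \<Longrightarrow> A \<in> M n \<Longrightarrow> B \<in> M n \<Longrightarrow> A \<union> B \<in> M n"
    and intersection: "\<And>n A B. 1 \<le> n \<Longrightarrow> A \<in> M n \<Longrightarrow> B \<in> M n \<Longrightarrow> A \<inter> B \<in> M n"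
    and complement: "\<And>n A. 1 \<le> n \<Longrightarrow> A \<in> M n \<Longrightarrow> euclidean_lists n - A \<in> M n"
    and product: "\<And>m n A B. 1 \<le> m \<Longrightarrow> 1 \<le> n \<Longrightarrow> A \<in> M m \<Longrightarrow> B \<in> M n \<Longrightarrow>
      {x @ y | x y. x \<in> A \<and> y \<in> B} \<in> M (m + n)"
    and projection: "\<And>n A K. 1 \<le> n \<Longrightarrow> A \<in> M n \<Longrightarrow> K \<subseteq> {..<n} \<Longrightarrow> K \<noteq> {} \<Longrightarrow>
      (\<lambda>x. nths x K) ` A \<in> M (card K)"
    and semialgebraic: "\<And>n f G. 1 \<le> n \<Longrightarrow> real_poly_fun n f \<Longrightarrow> finite G \<Longrightarrow>
      (\<And>g. g \<in> G \<Longrightarrow> real_poly_fun n g) \<Longrightarrow>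
      {x \<in> euclidean_lists n. f x = 0 \<and> (\<forall>g\<in>G. g x > 0)} \<in> M n"
    and tame: "M 1 = {(\<lambda>t. [t]) ` \<Union>F | F.
      finite F \<and> (\<forall>J\<in>F. (open J \<and> is_interval J) \<or> (\<exists>c::real. J = {c}))}"

definition definable :: "(nat \<Rightarrow> real list set set) \<Rightarrow> real list set \<Rightarrow> bool" where
  "definable M A \<longleftrightarrow> (\<exists>n\<ge>1. A \<in> M n)"

definition definable_fun_on ::
    "(nat \<Rightarrow> real list set set) \<Rightarrow> real set \<Rightarrow> (real \<Rightarrow> real) \<Rightarrow> bool" where
  "definable_fun_on M I f \<longleftrightarrow> definable M {[t, f t] | t. t \<in> I}"

text \<open>Continuous differentiability of order \<open>k\<close>, intended for open domains.\<close>

primrec Ck_on :: "nat \<Rightarrow> (real \<Rightarrow> real) \<Rightarrow> real set \<Rightarrow> bool" where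
  "Ck_on 0 f S \<longleftrightarrow> continuous_on S f"
| "Ck_on (Suc k) f S \<longleftrightarrow>
    (\<exists>D. (\<forall>x\<in>S. (f has_real_derivative D x) (at x)) \<and> Ck_on k D S)"

lemma Ck_on_1_iff: "Ck_on 1 f S \<longleftrightarrow> f C1_differentiable_on S"
  by (simp add: C1_differentiable_on_def has_real_derivative_iff_has_vector_derivative)

text \<open>All \<^emph>\<open>complex\<close> roots are required to be real.\<close>

definition hyperbolic :: "real poly \<Rightarrow> bool" where
  "hyperbolic p \<longleftrightarrow> lead_coeff p = 1 \<and>
    (\<forall>z. poly (map_poly complex_of_real p) z = 0 \<longrightarrow> z \<in> \<real>)"

definition signed_monic_poly :: "nat \<Rightarrow> (nat \<Rightarrow> real) \<Rightarrow> real poly" where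
  "signed_monic_poly n c = monom 1 n + (\<Sum>j=1..n. monom ((-1) ^ j * c j) (n - j))"

end

theory Submission
  imports Defs
    "HOL-Computational_Algebra.Fundamental_Theorem_Algebra"
    "HOL-Combinatorics.Permutations"
begin

text \<open>
  For \<open>n = 1\<close> the root is \<open>a 1\<close>; let \<open>n \<ge> 2\<close>, write \<open>P t\<close> for the polynomial at \<open>t\<close>, and fix \<open>e \<in> I\<close>.
  Everything rests on the behaviour of the roots at \<open>e\<close>, which is studied from the
  left and from the right separately.  On either side, take definable functions \<open>l j\<close> enumerating
  the roots of \<open>P t\<close>.  By o-minimality \<open>l j\<close> is comparable near \<open>e\<close> with every affine function;
  hence the bounded function \<open>l j\<close> has a limit \<open>v j\<close>, and the difference quotient
  \<open>(l j t - v j) / (t - e)\<close> has a limit \<open>L j\<close> as soon as it is bounded.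

  Boundedness is where hyperbolicity on both sides of \<open>e\<close> enters.  Let \<open>c\<close> be the product of
  \<open>x - w\<close> over the distinct roots \<open>w\<close> of \<open>P e\<close>.  The function
  \<open>T t = (\<Prod>j. 1 + (c (x j t))\<^sup>2)\<close>, where \<open>x j t\<close> are the roots of \<open>P t\<close>, is a polynomial in the
  coefficients of \<open>P t\<close>, hence twice differentiable; since all roots are real, it
  has a minimum at \<open>e\<close> with value \<open>1\<close>.  So \<open>T t - 1\<close> is of order \<open>(t - e)\<^sup>2\<close>, each \<open>c (x j t)\<close> is of
  order \<open>t - e\<close>, and so is the distance of \<open>x j t\<close> to its limit, because \<open>c\<close> has simple zeros
  (lemma \<open>quadratic_bound_at_hyperbolic_point\<close>).

  The speeds \<open>L j\<close> on the two sides agree up to order.  If \<open>w\<close> is a root of \<open>P e\<close> of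
  multiplicity \<open>m \<le> n\<close>, then \<open>P t (w + (t - e) * y) / (t - e) ^ m\<close> tends, on either side, to a
  nonzero constant times the product of \<open>y - L j\<close> over the \<open>j\<close> with \<open>v j = w\<close>.  The
  numerator is a \<open>C\<^sup>n\<close> function of \<open>t\<close>, so by Taylor's formula both one-sided limits are the same
  Taylor coefficient.  Thus the pairs \<open>(v j, L j)\<close> from the left and from the right
  coincide as multisets (lemma \<open>onesided_root_expansions_match\<close>), and any two
  one-sided enumerations can be renumbered so as to join in a differentiable way at \<open>e\<close>.

  Globally, the roots in increasing order are definable, and outside the finitely many points where
  the set \<open>{t. l i t = l k t}\<close> of some pair of indices has its frontier they are differentiable:
  roots that coincide at \<open>e\<close> coincide nearby, so renumbering them changes nothing.  At the
  finitely many remaining points one glues (lemma \<open>exists_differentiable_root_parametrization\<close>).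

  Finally a definable differentiable function is automatically \<open>C\<^sup>1\<close>
  (lemma \<open>definable_differentiable_imp_C1\<close>): its derivative is eventually above or eventually
  below any given value on each side of \<open>e\<close>, and by the mean value theorem only the side that is
  compatible with its value at \<open>e\<close> is possible.
\<close>

section \<open>Families of real roots\<close>

lemma poly_signed_monic_poly:
  "poly (signed_monic_poly n c) x = x ^ n + (\<Sum>j=1..n. (-1) ^ j * c j * x ^ (n - j))"
  by (simp add: signed_monic_poly_def poly_sum poly_monom)

lemma coeff_signed_monic_poly:
  assumes "j \<in> {1..n}"
  shows "coeff (signed_monic_poly n c) (n - j) = (-1) ^ j * c j"
proof -
  have "coeff (signed_monic_poly n c) (n - j)
      = (\<Sum>i=1..n. if i = j then (-1) ^ i * c i else 0)"
  proof -
    have "coeff (monom 1 n :: real poly) (n - j) = 0" using assms by auto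
    moreover have "(\<Sum>i=1..n. coeff (monom ((-1) ^ i * c i) (n - i)) (n - j))
        = (\<Sum>i=1..n. if i = j then (-1) ^ i * c i else 0)"
      by (rule sum.cong) (use assms in \<open>auto simp: coeff_monom\<close>)
    ultimately show ?thesis
      unfolding signed_monic_poly_def coeff_add coeff_sum by (simp only: add_0)
  qed
  then show ?thesis using assms by simp
qed

lemma coeff_signed_monic_poly_top: "coeff (signed_monic_poly n c) n = 1"
  by (auto simp: signed_monic_poly_def coeff_sum intro!: sum.neutral)

lemma degree_signed_monic_poly: "degree (signed_monic_poly n c) = n"
proof (rule antisym)
  show "degree (signed_monic_poly n c) \<le> n"
    unfolding signed_monic_poly_def
    by (intro degree_add_le degree_sum_le) (auto simp: degree_monom_eq intro: order_trans[OF degree_monom_le])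
  show "n \<le> degree (signed_monic_poly n c)"
    by (rule le_degree) (simp add: coeff_signed_monic_poly_top)
qed

definition root_poly :: "'i set \<Rightarrow> ('i \<Rightarrow> real) \<Rightarrow> real poly" where
  "root_poly A x = (\<Prod>j\<in>A. [:- x j, 1:])"

lemma poly_root_poly: "poly (root_poly A x) y = (\<Prod>j\<in>A. y - x j)"
  by (simp add: root_poly_def poly_prod)

lemma degree_root_poly: "degree (root_poly A x) = card A"
proof -
  have "degree (root_poly A x) = (\<Sum>j\<in>A. degree [:- x j, 1:])"
    unfolding root_poly_def by (rule degree_prod_sum_eq) auto
  then show ?thesis by simp
qed

lemma lead_coeff_root_poly: "lead_coeff (root_poly A x) = 1"
  unfolding root_poly_def by (simp add: lead_coeff_prod)

lemma proots_root_poly: "finite A \<Longrightarrow> proots (root_poly A x) = image_mset x (mset_set A)"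
  unfolding root_poly_def
proof (induction A rule: finite_induct)
  case (insert a A)
  have "(\<Prod>j\<in>A. [:- x j, 1:]) \<noteq> 0" using insert by (simp add: prod_zero_iff)
  then show ?case using insert by (simp add: proots_mult del: mult_pCons_left)
qed simp

lemma root_poly_eq_imp_image_mset_eq:
  assumes "finite A" "finite B" "root_poly A x = root_poly B y"
  shows "image_mset x (mset_set A) = image_mset y (mset_set B)"
  using assms proots_root_poly by metis

text \<open>
  Vieta's formulas.  They turn the condition of being a family of roots into polynomial equations,
  which is the form needed for definability.
\<close>

lemma signed_monic_poly_eq_root_poly_iff:
  "signed_monic_poly n c = root_poly {1..n} x \<longleftrightarrow>
    (\<forall>j\<in>{1..n}. c j = (-1) ^ j * coeff (root_poly {1..n} x) (n - j))" (is "?L \<longleftrightarrow> ?R")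
proof
  assume ?L
  show ?R
  proof
    fix j assume j: "j \<in> {1..n}"
    have "(-1) ^ j * coeff (root_poly {1..n} x) (n - j) = (-1) ^ j * ((-1) ^ j * c j)"
      using \<open>?L\<close> coeff_signed_monic_poly[OF j, of c] by simp
    then show "c j = (-1) ^ j * coeff (root_poly {1..n} x) (n - j)"
      by (simp flip: mult.assoc power_add add: mult_2[symmetric])
  qed
next
  assume R: ?R
  show ?L
  proof (rule poly_eqI)
    fix k
    consider "k < n" | "k = n" | "k > n" by linarith
    then show "coeff (signed_monic_poly n c) k = coeff (root_poly {1..n} x) k"
    proof cases
      case 1
      then have j: "n - k \<in> {1..n}" and k: "k = n - (n - k)" by auto
      have "coeff (signed_monic_poly n c) k = (-1) ^ (n - k) * c (n - k)"
        using coeff_signed_monic_poly[OF j, of c] k by simp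
      also have "\<dots> = coeff (root_poly {1..n} x) k"
        using R j k by (simp flip: mult.assoc power_add add: mult_2[symmetric])
      finally show ?thesis .
    next
      case 2
      then show ?thesis
        using lead_coeff_root_poly[of "{1..n}" x] by (simp add: coeff_signed_monic_poly_top degree_root_poly)
    next
      case 3
      then show ?thesis by (simp add: coeff_eq_0 degree_signed_monic_poly degree_root_poly)
    qed
  qed
qed

text \<open>
  An increasing enumeration is unique, since its list of values is the sorted list of the multiset.
\<close>

lemma mono_on_eq_of_image_mset_eq:
  fixes x y :: "nat \<Rightarrow> real"
  assumes "mono_on {1..n} x" "mono_on {1..n} y"
    and "image_mset x (mset_set {1..n}) = image_mset y (mset_set {1..n})" and "j \<in> {1..n}"
  shows "x j = y j"
proof -
  have srt: "sorted (map z [1..<Suc n])" if "mono_on {1..n} z" for z :: "nat \<Rightarrow> real"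
    unfolding sorted_map
    using that by (auto simp: sorted_wrt_iff_nth_less mono_on_def simp del: upt_Suc)
  have ms: "mset (map z [1..<Suc n]) = image_mset z (mset_set {1..n})" for z :: "nat \<Rightarrow> real"
    by (metis atLeastLessThanSuc_atLeastAtMost mset_map mset_upt)
  have "map x [1..<Suc n] = map y [1..<Suc n]"
    using srt[OF assms(1)] srt[OF assms(2)] ms assms(3) by (metis properties_for_sort sorted_sort_id)
  then show ?thesis using assms(4) unfolding map_eq_conv by (simp del: upt_Suc)
qed

lemma poly_eqI_eval:
  fixes p q :: "real poly"
  assumes "\<And>x. poly p x = poly q x"
  shows "p = q"
  using assms poly_eq_poly_eq_iff by blast

lemma map_poly_of_real_mult:
  "map_poly complex_of_real (p * q) = map_poly complex_of_real p * map_poly complex_of_real q"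
  by (intro poly_eqI) (simp add: coeff_map_poly coeff_mult)

text \<open>
  Over the complex numbers the polynomial splits into linear factors.  Hyperbolicity makes all of
  them real, so that the same factorization holds over the reals.
\<close>

lemma hyperbolic_imp_ordered_roots:
  assumes "hyperbolic p"
  shows "\<exists>x. mono_on {1..degree p} x \<and> p = root_poly {1..degree p} x"
proof -
  let ?q = "map_poly complex_of_real p"
  have lc: "lead_coeff p = 1" using assms by (simp add: hyperbolic_def)
  have deg: "degree ?q = degree p" by (simp add: degree_map_poly)
  have "?q \<noteq> 0" using lc deg by (metis coeff_map_poly of_real_0 of_real_1 zero_neq_one leading_coeff_0_iff)
  then obtain A where A: "size A = degree ?q" "?q = smult (lead_coeff ?q) (\<Prod>x\<in>#A. [:-x, 1:])"
    using alg_closed_imp_factorization by blast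
  have "lead_coeff ?q = 1" using lc deg by (simp add: coeff_map_poly)
  then have q: "?q = (\<Prod>x\<in>#A. [:-x, 1:])" using A(2) by simp
  have real: "z \<in> \<real>" if "z \<in># A" for z
  proof -
    have "poly ?q z = 0" unfolding q using that by (auto simp: poly_prod_mset prod_mset_zero_iff)
    then show ?thesis using assms by (simp add: hyperbolic_def)
  qed
  have "(\<Prod>x\<in>#A. [:-x, 1:]) = map_poly complex_of_real (\<Prod>x\<in>#image_mset Re A. [:-x, 1:])"
    using real
  proof (induction A)
    case (add z A)
    have "[:-z, 1:] = map_poly complex_of_real [:- Re z, 1:]"
      using add.prems[of z] by (auto simp: map_poly_pCons elim: Reals_cases)
    then show ?case using add by (simp add: map_poly_of_real_mult del: mult_pCons_left)
  qed simp
  then have pA: "p = (\<Prod>x\<in>#image_mset Re A. [:-x, 1:])"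
    using q by (metis (no_types, lifting) of_real_eq_iff poly_eqI coeff_map_poly of_real_0)
  define xs where "xs = sorted_list_of_multiset (image_mset Re A)"
  have len: "length xs = degree p" 
    using A(1) deg by (metis mset_sorted_list_of_multiset size_image_mset size_mset xs_def)
  have "p = prod_list (map (\<lambda>x. [:-x, 1:]) xs)"
  proof -
    have "prod_list (map (\<lambda>x. [:-x, 1:]) xs) = (\<Prod>x\<in>#mset xs. [:-x, 1:])"
      by (simp only: mset_map flip: prod_mset_prod_list)
    also have "mset xs = image_mset Re A" by (simp add: xs_def)
    finally show ?thesis using pA by (simp only:)
  qed
  also have "\<dots> = (\<Prod>i<degree p. [:- (xs ! i), 1:])"
    using len by (simp add: prod.list_conv_set_nth atLeast0LessThan)
  also have "\<dots> = root_poly {1..degree p} (\<lambda>j. xs ! (j - 1))"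
    unfolding root_poly_def
    by (rule prod.reindex_bij_witness[of _ "\<lambda>j. j - 1" Suc]) auto
  finally have "p = root_poly {1..degree p} (\<lambda>j. xs ! (j - 1))" .
  moreover have "mono_on {1..degree p} (\<lambda>j. xs ! (j - 1))"
    unfolding mono_on_def using len
    by (auto intro!: sorted_nth_mono simp: xs_def)
  ultimately show ?thesis by blast
qed

text \<open>
  This will be applied with \<open>v j\<close> the limit of the \<open>j\<close>-th root and \<open>L j\<close> the limit of its
  difference quotient.  A polynomial determines the multiset of its roots; doing this once for the
  \<open>v j\<close> and then for the \<open>L j\<close> over each fixed value \<open>w\<close> of \<open>v\<close> determines the multiset of pairs.
\<close>

lemma permutation_matching_pairs:
  assumes "finite A" and v: "root_poly A v = root_poly A v'"
    and L: "\<And>w. root_poly {j\<in>A. v j = w} L = root_poly {j\<in>A. v' j = w} L'"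
  obtains s where "s permutes A" "\<And>j. j \<in> A \<Longrightarrow> v' (s j) = v j \<and> L' (s j) = L j"
proof -
  have cnt: "count (image_mset (\<lambda>j. (v j, L j)) (mset_set A)) (w, m)
      = count (image_mset L (mset_set {j\<in>A. v j = w})) m" for w m and v L :: "'a \<Rightarrow> real"
  proof -
    have "{j \<in> {j\<in>A. v j = w}. m = L j} = {j \<in> A. (w, m) = (v j, L j)}" by auto
    then show ?thesis using assms(1) by (simp add: count_image_mset')
  qed
  have eq: "image_mset (\<lambda>j. (v j, L j)) (mset_set A) = image_mset (\<lambda>j. (v' j, L' j)) (mset_set A)"
  proof (rule multiset_eqI)
    fix wm :: "real \<times> real"
    obtain w m where "wm = (w, m)" by (cases wm)
    then show "count (image_mset (\<lambda>j. (v j, L j)) (mset_set A)) wm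
        = count (image_mset (\<lambda>j. (v' j, L' j)) (mset_set A)) wm"
      using root_poly_eq_imp_image_mset_eq[OF _ _ L[of w]] assms(1) by (simp add: cnt)
  qed
  show thesis
    by (rule image_mset_eq_implies_permutes[OF assms(1) eq]) (auto intro: that)
qed

section \<open>Taylor expansions at a point\<close>

text \<open>
  A Taylor expansion of order \<open>m\<close> at \<open>e\<close> with remainder in Peano's form.  The polynomial may have
  any degree, so that products need no truncation.  The first conjunct ties the value at \<open>e\<close> to the
  expansion, since the limit at \<open>e\<close> disregards it.
\<close>

definition taylor_germ :: "nat \<Rightarrow> real \<Rightarrow> (real \<Rightarrow> real) \<Rightarrow> bool" where
  "taylor_germ m e f \<longleftrightarrow>
    (\<exists>p. f e = poly p 0 \<and> ((\<lambda>t. (f t - poly p (t - e)) / (t - e) ^ m) \<longlongrightarrow> 0) (at e))"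

lemma taylor_germI:
  "f e = poly p 0 \<Longrightarrow> ((\<lambda>t. (f t - poly p (t - e)) / (t - e) ^ m) \<longlongrightarrow> 0) (at e) \<Longrightarrow> taylor_germ m e f"
  by (auto simp: taylor_germ_def)

lemma taylor_germ_poly: "taylor_germ m e (\<lambda>t. poly p (t - e))"
  by (rule taylor_germI[of _ _ p]) simp_all

lemma taylor_germ_const: "taylor_germ m e (\<lambda>t. c)"
  using taylor_germ_poly[of m e "[:c:]"] by simp

lemma taylor_germ_mono:
  assumes "taylor_germ m e f" "k \<le> m"
  shows "taylor_germ k e f"
proof -
  obtain p where p: "f e = poly p 0" "((\<lambda>t. (f t - poly p (t - e)) / (t - e) ^ m) \<longlongrightarrow> 0) (at e)"
    using assms(1) by (auto simp: taylor_germ_def)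
  have "((\<lambda>t. (f t - poly p (t - e)) / (t - e) ^ m * (t - e) ^ (m - k)) \<longlongrightarrow> 0 * (e - e) ^ (m - k)) (at e)"
    by (intro tendsto_intros p)
  moreover have "\<forall>\<^sub>F t in at e. (f t - poly p (t - e)) / (t - e) ^ m * (t - e) ^ (m - k)
      = (f t - poly p (t - e)) / (t - e) ^ k"
    unfolding eventually_at_topological
  proof (intro exI[of _ UNIV] conjI ballI impI)
    fix t assume "t \<noteq> e"
    moreover have "(t - e) ^ m = (t - e) ^ k * (t - e) ^ (m - k)"
      using assms(2) by (simp flip: power_add)
    ultimately show "(f t - poly p (t - e)) / (t - e) ^ m * (t - e) ^ (m - k)
      = (f t - poly p (t - e)) / (t - e) ^ k" by simp
  qed auto
  ultimately have "((\<lambda>t. (f t - poly p (t - e)) / (t - e) ^ k) \<longlongrightarrow> 0) (at e)"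
    by (simp add: tendsto_cong)
  then show ?thesis using p(1) taylor_germI by blast
qed

lemma taylor_germ_tendsto:
  assumes "taylor_germ m e f"
  shows "(f \<longlongrightarrow> f e) (at e)"
proof -
  obtain p where p: "f e = poly p 0" "((\<lambda>t. f t - poly p (t - e)) \<longlongrightarrow> 0) (at e)"
    using taylor_germ_mono[OF assms, of 0] by (auto simp: taylor_germ_def)
  have "((\<lambda>t. f t - poly p (t - e) + poly p (t - e)) \<longlongrightarrow> 0 + poly p (e - e)) (at e)"
    by (intro tendsto_intros p)
  then show ?thesis using p(1) by simp
qed

lemma taylor_germ_add:
  assumes "taylor_germ m e f" "taylor_germ m e g"
  shows "taylor_germ m e (\<lambda>t. f t + g t)"
proof -
  obtain p where p: "f e = poly p 0" "((\<lambda>t. (f t - poly p (t - e)) / (t - e) ^ m) \<longlongrightarrow> 0) (at e)"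
    using assms(1) by (auto simp: taylor_germ_def)
  obtain q where q: "g e = poly q 0" "((\<lambda>t. (g t - poly q (t - e)) / (t - e) ^ m) \<longlongrightarrow> 0) (at e)"
    using assms(2) by (auto simp: taylor_germ_def)
  show ?thesis
  proof (rule taylor_germI[of _ _ "p + q"])
    show "((\<lambda>t. (f t + g t - poly (p + q) (t - e)) / (t - e) ^ m) \<longlongrightarrow> 0) (at e)"
      using tendsto_add[OF p(2) q(2)] by (simp add: algebra_simps flip: add_divide_distrib)
  qed (simp add: p q)
qed

lemma taylor_germ_mult:
  assumes "taylor_germ m e f" "taylor_germ m e g"
  shows "taylor_germ m e (\<lambda>t. f t * g t)"
proof -
  obtain p where p: "f e = poly p 0" "((\<lambda>t. (f t - poly p (t - e)) / (t - e) ^ m) \<longlongrightarrow> 0) (at e)"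
    using assms(1) by (auto simp: taylor_germ_def)
  obtain q where q: "g e = poly q 0" "((\<lambda>t. (g t - poly q (t - e)) / (t - e) ^ m) \<longlongrightarrow> 0) (at e)"
    using assms(2) by (auto simp: taylor_germ_def)
  have "((\<lambda>t. f t * ((g t - poly q (t - e)) / (t - e) ^ m)
        + poly q (t - e) * ((f t - poly p (t - e)) / (t - e) ^ m)) \<longlongrightarrow> f e * 0 + poly q (e - e) * 0) (at e)"
    by (intro tendsto_intros p q taylor_germ_tendsto[OF assms(1)])
  moreover have "f t * ((g t - poly q (t - e)) / (t - e) ^ m)
        + poly q (t - e) * ((f t - poly p (t - e)) / (t - e) ^ m)
      = (f t * g t - poly (p * q) (t - e)) / (t - e) ^ m" for t
    by (simp add: algebra_simps diff_divide_distrib)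
  ultimately show ?thesis
    by (intro taylor_germI[of _ _ "p * q"]) (simp_all add: p q)
qed

lemma taylor_germ_sum: "(\<And>i. i \<in> A \<Longrightarrow> taylor_germ m e (f i)) \<Longrightarrow> taylor_germ m e (\<lambda>t. \<Sum>i\<in>A. f i t)"
  by (induction A rule: infinite_finite_induct) (auto intro: taylor_germ_const taylor_germ_add)

lemma taylor_germ_power: "taylor_germ m e f \<Longrightarrow> taylor_germ m e (\<lambda>t. f t ^ k)"
  by (induction k) (auto intro: taylor_germ_const taylor_germ_mult)

lemma antiderivative_poly: "\<exists>q :: real poly. pderiv q = p \<and> coeff q 0 = c"
proof -
  define q where "q = [:c:] + (\<Sum>i\<le>degree p. monom (coeff p i / real (Suc i)) (Suc i))"
  have "coeff q (Suc k) = coeff p k / real (Suc k)" for k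
  proof -
    have "coeff q (Suc k) = (\<Sum>i\<le>degree p. if i = k then coeff p i / real (Suc i) else 0)"
      by (simp add: q_def coeff_sum)
    then show ?thesis by (auto simp: coeff_eq_0)
  qed
  then have "pderiv q = p" by (intro poly_eqI) (simp add: coeff_pderiv)
  moreover have "coeff q 0 = c" by (simp add: q_def coeff_sum)
  ultimately show ?thesis by blast
qed

text \<open>
  Induction on the order: an antiderivative \<open>q\<close> of the Taylor polynomial of the derivative is a Taylor
  polynomial of \<open>f\<close>, and bounding \<open>f t - q (t - e)\<close> along the segment from \<open>e\<close> to \<open>t\<close> by its derivative
  gains the missing factor \<open>t - e\<close>.
\<close>

lemma Ck_on_imp_taylor_germ:
  assumes "open S" "e \<in> S" "Ck_on m f S"
  shows "taylor_germ m e f"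
  using assms(3)
proof (induction m arbitrary: f)
  case 0
  then have "(f \<longlongrightarrow> f e) (at e)" using assms by (simp add: continuous_on_eq_continuous_at isCont_def)
  then show ?case by (intro taylor_germI[of _ _ "[:f e:]"]) (simp_all add: LIM_zero)
next
  case (Suc m)
  then obtain D where D: "\<And>x. x \<in> S \<Longrightarrow> (f has_real_derivative D x) (at x)" "Ck_on m D S" by auto
  obtain p where p: "D e = poly p 0" "((\<lambda>t. (D t - poly p (t - e)) / (t - e) ^ m) \<longlongrightarrow> 0) (at e)"
    using Suc.IH[OF D(2)] by (auto simp: taylor_germ_def)
  obtain q where q: "pderiv q = p" "coeff q 0 = f e" using antiderivative_poly by blast
  define h where "h t = f t - poly q (t - e)" for t
  define h' where "h' t = D t - poly p (t - e)" for t
  have h': "(h has_real_derivative h' x) (at x)" if "x \<in> S" for x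
  proof -
    have "((\<lambda>t. poly q (t - e)) has_real_derivative poly p (x - e) * (1 - 0)) (at x)"
      unfolding q(1)[symmetric] by (rule DERIV_chain2[OF poly_DERIV]) (intro derivative_intros)
    then show ?thesis unfolding h_def h'_def using D(1)[OF that] by (auto intro: DERIV_diff)
  qed
  have he: "h e = 0" using q(2) by (simp add: h_def poly_0_coeff_0)
  have "((\<lambda>t. h t / (t - e) ^ Suc m) \<longlongrightarrow> 0) (at e)"
  proof (rule tendstoI)
    fix \<epsilon> :: real assume eps: "\<epsilon> > 0"
    have "\<forall>\<^sub>F t in at e. \<bar>h' t / (t - e) ^ m\<bar> < \<epsilon> / 2"
      using tendstoD[OF p(2), of "\<epsilon> / 2"] eps by (simp add: h'_def)
    then obtain d1 where d1: "d1 > 0" "\<And>t. t \<noteq> e \<Longrightarrow> dist t e < d1 \<Longrightarrow> \<bar>h' t / (t - e) ^ m\<bar> < \<epsilon> / 2"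
      by (auto simp: eventually_at)
    obtain d2 where d2: "d2 > 0" "ball e d2 \<subseteq> S" using assms(1,2) open_contains_ball by blast
    define d where "d = min d1 d2"
    have "dist (h t / (t - e) ^ Suc m) 0 < \<epsilon>" if t: "t \<noteq> e" "dist t e < d" for t
    proof -
      have seg: "\<bar>z - e\<bar> \<le> \<bar>t - e\<bar>" if "z \<in> closed_segment e t" for z
        using that by (auto simp: closed_segment_eq_real_ivl split: if_splits)
      have "norm (h t - h e) \<le> (\<epsilon> / 2 * \<bar>t - e\<bar> ^ m) * norm (t - e)"
      proof (rule field_differentiable_bound[of "closed_segment e t" h h'])
        fix z assume z: "z \<in> closed_segment e t"
        then have ze: "\<bar>z - e\<bar> < d" using seg[OF z] t by (simp add: dist_real_def)
        then have "z \<in> S" using d2 by (auto simp: d_def dist_real_def)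
        then show "(h has_field_derivative h' z) (at z within closed_segment e t)"
          by (rule has_field_derivative_at_within[OF h'])
        show "norm (h' z) \<le> \<epsilon> / 2 * \<bar>t - e\<bar> ^ m"
        proof (cases "z = e")
          case True
          then show ?thesis using p(1) eps by (simp add: h'_def)
        next
          case False
          have "\<bar>h' z / (z - e) ^ m\<bar> < \<epsilon> / 2" using d1(2)[OF False] ze by (simp add: d_def dist_real_def)
          then have "\<bar>h' z\<bar> \<le> \<epsilon> / 2 * \<bar>z - e\<bar> ^ m" using False
            by (simp add: abs_divide power_abs divide_simps split: if_splits)
          also have "\<dots> \<le> \<epsilon> / 2 * \<bar>t - e\<bar> ^ m"
            using eps seg[OF z] by (intro mult_left_mono power_mono) auto
          finally show ?thesis by simp
        qed
      qed auto
      then have "\<bar>h t\<bar> \<le> \<epsilon> / 2 * \<bar>t - e\<bar> ^ Suc m" using he by (simp add: mult_ac)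
      then have "\<bar>h t / (t - e) ^ Suc m\<bar> \<le> \<epsilon> / 2"
        using t by (simp add: abs_divide power_abs divide_simps abs_mult split: if_splits)
      then show ?thesis using eps unfolding dist_real_def diff_0_right by linarith
    qed
    then show "\<forall>\<^sub>F t in at e. dist (h t / (t - e) ^ Suc m) 0 < \<epsilon>"
      unfolding eventually_at using d1(1) d2(1) by (intro exI[of _ d]) (auto simp: d_def)
  qed
  then show ?case
    by (intro taylor_germI[of _ _ q]) (simp_all add: h_def q(2) poly_0_coeff_0)
qed

text \<open>
  If \<open>m > 0\<close>, the existence of a limit forces the constant term of \<open>p\<close> to vanish, and one power of \<open>t - e\<close>
  cancels; for \<open>m = 0\<close> both limits are the value of \<open>p\<close> at \<open>0\<close>.
\<close>

lemma poly_onesided_limits_eq: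
  fixes p :: "real poly"
  assumes "((\<lambda>t. poly p (t - e) / (t - e) ^ m) \<longlongrightarrow> A) (at_right e)"
    and "((\<lambda>t. poly p (t - e) / (t - e) ^ m) \<longlongrightarrow> B) (at_left e)"
  shows "A = B"
  using assms
proof (induction m arbitrary: p)
  case 0
  have "((\<lambda>t. poly p (t - e)) \<longlongrightarrow> poly p (e - e)) (at e)" by (intro tendsto_intros)
  then have "((\<lambda>t. poly p (t - e)) \<longlongrightarrow> poly p 0) (at_right e)" "((\<lambda>t. poly p (t - e)) \<longlongrightarrow> poly p 0) (at_left e)"
    by (simp_all add: filterlim_at_split)
  then show ?case
    using 0 tendsto_unique[OF trivial_limit_at_right_real, of "\<lambda>t. poly p (t - e)"]
      tendsto_unique[OF trivial_limit_at_left_real, of "\<lambda>t. poly p (t - e)"] by fastforce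
next
  case (Suc m)
  have "((\<lambda>t. poly p (t - e) / (t - e) ^ Suc m * (t - e) ^ Suc m) \<longlongrightarrow> A * (e - e) ^ Suc m) (at_right e)"
    by (intro tendsto_intros Suc.prems)
  moreover have "\<forall>\<^sub>F t in at_right e. poly p (t - e) / (t - e) ^ Suc m * (t - e) ^ Suc m = poly p (t - e)"
    by (auto simp: eventually_at_right_field intro: exI[of _ "e + 1"])
  ultimately have "((\<lambda>t. poly p (t - e)) \<longlongrightarrow> 0) (at_right e)" by (simp add: tendsto_cong)
  moreover have "((\<lambda>t. poly p (t - e)) \<longlongrightarrow> poly p (e - e)) (at_right e)"
    by (intro tendsto_intros)
  ultimately have "poly p 0 = 0" using tendsto_unique trivial_limit_at_right_real by fastforce
  then obtain q where q: "p = pCons 0 q" by (metis pCons_cases poly_pCons mult_zero_left add.right_neutral)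
  have eq: "t \<noteq> e \<Longrightarrow> poly p (t - e) / (t - e) ^ Suc m = poly q (t - e) / (t - e) ^ m" for t
    by (simp add: q)
  show ?case
  proof (rule Suc.IH)
    show "((\<lambda>t. poly q (t - e) / (t - e) ^ m) \<longlongrightarrow> A) (at_right e)"
      using Suc.prems(1) by (rule Lim_transform_eventually) (auto simp: eventually_at_filter eq simp del: power_Suc)
    show "((\<lambda>t. poly q (t - e) / (t - e) ^ m) \<longlongrightarrow> B) (at_left e)"
      using Suc.prems(2) by (rule Lim_transform_eventually) (auto simp: eventually_at_filter eq simp del: power_Suc)
  qed
qed

text \<open>
  This is how information passes from one side of \<open>e\<close> to the other: both limits are the
  coefficient of order \<open>m\<close> of one Taylor polynomial.
\<close>

lemma taylor_germ_onesided_limits_eq: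
  assumes "taylor_germ m e f"
    and "((\<lambda>t. f t / (t - e) ^ m) \<longlongrightarrow> A) (at_right e)"
    and "((\<lambda>t. f t / (t - e) ^ m) \<longlongrightarrow> B) (at_left e)"
  shows "A = B"
proof -
  obtain p where p: "((\<lambda>t. (f t - poly p (t - e)) / (t - e) ^ m) \<longlongrightarrow> 0) (at e)"
    using assms(1) by (auto simp: taylor_germ_def)
  have *: "((\<lambda>t. poly p (t - e) / (t - e) ^ m) \<longlongrightarrow> C) F"
    if "F \<le> at e" "((\<lambda>t. f t / (t - e) ^ m) \<longlongrightarrow> C) F" for F C
    using tendsto_diff[OF that(2) tendsto_mono[OF that(1) p]] by (simp add: diff_divide_distrib)
  show ?thesis
    by (rule poly_onesided_limits_eq[OF *[OF _ assms(2)] *[OF _ assms(3)]]) (simp_all add: at_le)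
qed

text \<open>
  At a minimum the linear Taylor coefficient vanishes, because the difference quotients are nonnegative
  on the right and nonpositive on the left.
\<close>

lemma taylor_germ_minimum:
  assumes "taylor_germ 2 e f" and min: "\<forall>\<^sub>F t in at e. f e \<le> f t"
  obtains K where "\<forall>\<^sub>F t in at e. f t - f e \<le> K * (t - e)\<^sup>2"
proof -
  obtain p where p: "f e = poly p 0" "((\<lambda>t. (f t - poly p (t - e)) / (t - e)\<^sup>2) \<longlongrightarrow> 0) (at e)"
    using assms(1) by (auto simp: taylor_germ_def)
  obtain c0 c1 r where "p = pCons c0 (pCons c1 r)" by (metis pCons_cases)
  then have P: "poly p s = f e + s * (c1 + s * poly r s)" for s using p(1) by simp
  have div_eq: "(y - (f e + s * (c1 + s * z))) / s\<^sup>2 * s + (c1 + s * z) = (y - f e) / s"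
      "(y - (f e + s * (s * z))) / s\<^sup>2 + z = (y - f e) / s\<^sup>2"
    if "s \<noteq> 0" for s y z :: real
    using that by (simp_all add: field_simps power2_eq_square)
  have lim: "((\<lambda>t. (f t - f e) / (t - e)) \<longlongrightarrow> c1) (at e)"
  proof -
    have "((\<lambda>t. (f t - poly p (t - e)) / (t - e)\<^sup>2 * (t - e) + (c1 + (t - e) * poly r (t - e)))
        \<longlongrightarrow> 0 * (e - e) + (c1 + (e - e) * poly r (e - e))) (at e)"
      by (intro tendsto_intros p)
    moreover have "t \<noteq> e \<Longrightarrow> (f t - poly p (t - e)) / (t - e)\<^sup>2 * (t - e) + (c1 + (t - e) * poly r (t - e))
      = (f t - f e) / (t - e)" for t using div_eq(1)[of "t - e" "f t" "poly r (t - e)"] by (simp add: P)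
    ultimately show ?thesis by (auto elim!: Lim_transform_eventually simp: eventually_at_filter)
  qed
  have "c1 \<ge> 0"
  proof (rule tendsto_lowerbound)
    show "((\<lambda>t. (f t - f e) / (t - e)) \<longlongrightarrow> c1) (at_right e)"
      using lim by (rule tendsto_mono[rotated]) (simp add: at_le)
    have "\<forall>\<^sub>F t in at_right e. f e \<le> f t" using min by (simp add: eventually_at_split)
    then show "\<forall>\<^sub>F t in at_right e. 0 \<le> (f t - f e) / (t - e)"
      by (auto simp: eventually_at_filter elim!: eventually_mono)
  qed simp
  moreover have "c1 \<le> 0"
  proof (rule tendsto_upperbound)
    show "((\<lambda>t. (f t - f e) / (t - e)) \<longlongrightarrow> c1) (at_left e)"
      using lim by (rule tendsto_mono[rotated]) (simp add: at_le)
    have "\<forall>\<^sub>F t in at_left e. f e \<le> f t" using min by (simp add: eventually_at_split)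
    then show "\<forall>\<^sub>F t in at_left e. (f t - f e) / (t - e) \<le> 0"
      by (auto simp: eventually_at_filter divide_le_0_iff elim!: eventually_mono)
  qed simp
  ultimately have c1: "c1 = 0" by simp
  have "((\<lambda>t. (f t - poly p (t - e)) / (t - e)\<^sup>2 + poly r (t - e)) \<longlongrightarrow> 0 + poly r (e - e)) (at e)"
    by (intro tendsto_intros p)
  moreover have "t \<noteq> e \<Longrightarrow> (f t - poly p (t - e)) / (t - e)\<^sup>2 + poly r (t - e) = (f t - f e) / (t - e)\<^sup>2" for t
    using div_eq(2)[of "t - e" "f t" "poly r (t - e)"] by (simp add: P c1)
  ultimately have "((\<lambda>t. (f t - f e) / (t - e)\<^sup>2) \<longlongrightarrow> poly r 0) (at e)"
    by (auto elim!: Lim_transform_eventually simp: eventually_at_filter)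
  then have "\<forall>\<^sub>F t in at e. (f t - f e) / (t - e)\<^sup>2 < poly r 0 + 1" by (rule order_tendstoD) simp
  then have "\<forall>\<^sub>F t in at e. f t - f e \<le> (poly r 0 + 1) * (t - e)\<^sup>2"
    by (auto simp: eventually_at_filter divide_simps mult.commute elim!: eventually_mono split: if_splits)
  then show thesis using that by blast
qed

section \<open>One-sided expansions of the roots\<close>

text \<open>
  The limit is the supremum of the constants that are eventually below \<open>h\<close>.
\<close>

lemma tendsto_of_bounded_comparable:
  fixes h :: "'a \<Rightarrow> real"
  assumes "F \<noteq> bot" and bdd: "\<forall>\<^sub>F t in F. \<bar>h t\<bar> \<le> B"
    and cmp: "\<And>c. (\<forall>\<^sub>F t in F. h t \<le> c) \<or> (\<forall>\<^sub>F t in F. c \<le> h t)"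
  obtains L where "(h \<longlongrightarrow> L) F"
proof -
  define S where "S = {c. \<forall>\<^sub>F t in F. c \<le> h t}"
  have "- B \<in> S" using bdd by (auto simp: S_def elim!: eventually_mono)
  have le: "c \<le> B" if "c \<in> S" for c
  proof -
    have "\<forall>\<^sub>F t in F. c \<le> B" using that bdd unfolding S_def mem_Collect_eq
      by eventually_elim auto
    then show ?thesis using \<open>F \<noteq> bot\<close> by simp
  qed
  then have bS: "bdd_above S" by (rule bdd_aboveI)
  have "(h \<longlongrightarrow> Sup S) F"
  proof (rule order_tendstoI)
    fix a assume "a < Sup S"
    then obtain c where "c \<in> S" "a < c" using \<open>- B \<in> S\<close> bS less_cSup_iff by blast
    then show "\<forall>\<^sub>F t in F. a < h t" unfolding S_def mem_Collect_eq by (auto elim!: eventually_mono)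
  next
    fix a assume a: "Sup S < a"
    define c where "c = (Sup S + a) / 2"
    have "c \<notin> S" using a cSup_upper[OF _ bS, of c] by (auto simp: c_def)
    then have "\<forall>\<^sub>F t in F. h t \<le> c" using cmp[of c] by (simp add: S_def)
    then show "\<forall>\<^sub>F t in F. h t < a" using a by (auto simp: c_def elim!: eventually_mono)
  qed
  then show thesis using that by blast
qed

lemma poly_map_of_real_root_poly:
  "poly (map_poly complex_of_real (root_poly A x)) w = (\<Prod>j\<in>A. w - of_real (x j))"
  unfolding root_poly_def
  by (induction A rule: infinite_finite_induct)
    (simp_all add: map_poly_of_real_mult map_poly_pCons del: mult_pCons_left)

text \<open>
  Factor \<open>c + \<i> = (\<Prod>w\<in>#W. x - w)\<close> over the complex numbers.  For a polynomial \<open>p\<close> with roots \<open>x j\<close>, the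
  products of \<open>c (x j) + \<i>\<close> over \<open>j\<close> and of \<open>p w\<close> over \<open>w\<close> both consist of all differences of an \<open>x j\<close>
  and a \<open>w\<close>, so they agree up to sign; moreover \<open>\<bar>c (x j) + \<i>\<bar>\<^sup>2 = 1 + (c (x j))\<^sup>2\<close>.  This expresses
  the symmetric function \<open>\<Prod>j. 1 + (c (x j))\<^sup>2\<close> of the roots through the coefficients of \<open>p\<close>, with a \<open>W\<close>
  that is independent of \<open>p\<close>.
\<close>

lemma sum_of_squares_certificate:
  assumes "degree c > 0" "lead_coeff c = 1"
  obtains W :: "complex multiset" where
    "\<And>(A :: 'i set) x. finite A \<Longrightarrow>
      (cmod (\<Prod>w\<in>#W. poly (map_poly complex_of_real (root_poly A x)) w))\<^sup>2 = (\<Prod>j\<in>A. 1 + (poly c (x j))\<^sup>2)"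
proof -
  define q where "q = map_poly complex_of_real c + [:\<i>:]"
  have dc: "degree (map_poly complex_of_real c) = degree c" by (simp add: degree_map_poly)
  have "degree q = degree c" unfolding q_def using assms(1) dc by (subst degree_add_eq_left) auto
  moreover have "coeff q (degree c) = 1" using assms by (simp add: q_def coeff_map_poly coeff_pCons split: nat.split)
  ultimately have lc: "lead_coeff q = 1" by simp
  then have "q \<noteq> 0" by auto
  then obtain W where W: "q = smult (lead_coeff q) (\<Prod>w\<in>#W. [:-w, 1:])"
    using alg_closed_imp_factorization by blast
  have eval: "(\<Prod>w\<in>#W. of_real r - w) = of_real (poly c r) + \<i>" for r
  proof -
    have "poly (map_poly complex_of_real c) (of_real r) = of_real (poly c r)"
      by (simp add: poly_altdef dc coeff_map_poly)
    then have "poly q (of_real r) = of_real (poly c r) + \<i>" by (simp add: q_def)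
    then show ?thesis using W unfolding lc by (simp add: poly_prod_mset)
  qed
  have comm: "cmod (\<Prod>w\<in>#W. w - z) = cmod (\<Prod>w\<in>#W. z - w)" for z
    by (induction W) (simp_all add: norm_mult norm_minus_commute)
  show thesis
  proof (rule that)
    fix A :: "'i set" and x assume "finite A"
    then show "(cmod (\<Prod>w\<in>#W. poly (map_poly complex_of_real (root_poly A x)) w))\<^sup>2 = (\<Prod>j\<in>A. 1 + (poly c (x j))\<^sup>2)"
      unfolding poly_map_of_real_root_poly
    proof (induction A rule: finite_induct)
      case (insert i A)
      have "(cmod (\<Prod>w\<in>#W. w - of_real (x i)))\<^sup>2 = 1 + (poly c (x i))\<^sup>2"
        unfolding comm eval by (simp add: cmod_power2)
      then show ?case using insert
        by (simp add: prod_mset.distrib norm_mult power_mult_distrib)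
    qed simp
  qed
qed

lemma taylor_germ_cmod_prod_mset:
  assumes "\<And>w. taylor_germ m e (\<lambda>t. Re (g w t))" "\<And>w. taylor_germ m e (\<lambda>t. Im (g w t))"
  shows "taylor_germ m e (\<lambda>t. (cmod (\<Prod>w\<in>#W. g w t))\<^sup>2)"
proof -
  have "taylor_germ m e (\<lambda>t. Re (\<Prod>w\<in>#W. g w t)) \<and> taylor_germ m e (\<lambda>t. Im (\<Prod>w\<in>#W. g w t))"
  proof (induction W)
    case (add w W)
    have "taylor_germ m e (\<lambda>t. - 1 * f t)" if "taylor_germ m e f" for f
      by (intro taylor_germ_mult taylor_germ_const that)
    from this[of "\<lambda>t. Im (g w t) * Im (\<Prod>w\<in>#W. g w t)"] assms add
    have "taylor_germ m e (\<lambda>t. Re (g w t) * Re (\<Prod>w\<in>#W. g w t) + - 1 * (Im (g w t) * Im (\<Prod>w\<in>#W. g w t)))"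
      by (intro taylor_germ_add taylor_germ_mult) (auto intro: taylor_germ_const)
    moreover have "taylor_germ m e (\<lambda>t. Re (g w t) * Im (\<Prod>w\<in>#W. g w t) + Im (g w t) * Re (\<Prod>w\<in>#W. g w t))"
      using assms add by (intro taylor_germ_add taylor_germ_mult) auto
    ultimately show ?case by simp
  qed (simp add: taylor_germ_const)
  then show ?thesis unfolding cmod_power2 by (auto intro: taylor_germ_add taylor_germ_power)
qed

lemma taylor_germ_coeff_signed_monic_poly:
  assumes "\<And>j. j \<in> {1..n} \<Longrightarrow> taylor_germ m e (a j)"
  shows "taylor_germ m e (\<lambda>t. coeff (signed_monic_poly n (\<lambda>j. a j t)) i)"
proof -
  have "taylor_germ m e (\<lambda>t. coeff (monom 1 n) i + (\<Sum>j=1..n. (if n - j = i then (-1) ^ j else 0) * a j t))"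
    by (intro taylor_germ_add taylor_germ_const taylor_germ_sum taylor_germ_mult assms)
  then show ?thesis
    unfolding signed_monic_poly_def by (simp add: coeff_sum if_distrib[of "\<lambda>x. x * _"] cong: if_cong)
qed

text \<open>
  With \<open>c\<close> the product of \<open>x - w\<close> over the distinct roots \<open>w\<close> of \<open>P e\<close>, the
  function \<open>T t = (\<Prod>j. 1 + (c (x j))\<^sup>2)\<close> of the roots \<open>x j\<close> of \<open>P t\<close> has a Taylor expansion of order
  \<open>2\<close> at \<open>e\<close> by \<open>sum_of_squares_certificate\<close>.  It is at least \<open>1\<close> wherever all roots are real, and equals
  \<open>1\<close> at \<open>e\<close>.  Hence, near \<open>e\<close>, it exceeds \<open>1\<close> by at most \<open>K * (t - e)\<^sup>2\<close>, and each \<open>(c (x j))\<^sup>2\<close> is bounded by the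
  excess.
\<close>

lemma quadratic_bound_at_hyperbolic_point:
  assumes "2 \<le> n" and tg: "\<And>j. j \<in> {1..n} \<Longrightarrow> taylor_germ 2 e (a j)"
    and hyp: "\<forall>\<^sub>F t in at e. hyperbolic (signed_monic_poly n (\<lambda>j. a j t))"
    and v: "signed_monic_poly n (\<lambda>j. a j e) = root_poly {1..n} v"
  obtains K where "\<forall>\<^sub>F t in at e. \<forall>x. signed_monic_poly n (\<lambda>j. a j t) = root_poly {1..n} x \<longrightarrow>
      (\<forall>j\<in>{1..n}. (\<Prod>w\<in>v ` {1..n}. x j - w)\<^sup>2 \<le> K * (t - e)\<^sup>2)"
proof -
  let ?P = "\<lambda>t. signed_monic_poly n (\<lambda>j. a j t)"
  define c where "c = root_poly (v ` {1..n}) id"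
  have c: "poly c x = (\<Prod>w\<in>v ` {1..n}. x - w)" for x by (simp add: c_def poly_root_poly)
  have "degree c > 0" using \<open>2 \<le> n\<close> unfolding c_def degree_root_poly by (simp add: card_gt_0_iff)
  then obtain W :: "complex multiset" where
    W: "\<And>(A :: nat set) x. finite A \<Longrightarrow>
      (cmod (\<Prod>w\<in>#W. poly (map_poly complex_of_real (root_poly A x)) w))\<^sup>2 = (\<Prod>j\<in>A. 1 + (poly c (x j))\<^sup>2)"
    using sum_of_squares_certificate[of c] lead_coeff_root_poly unfolding c_def by metis
  define T where "T t = (cmod (\<Prod>w\<in>#W. poly (map_poly complex_of_real (?P t)) w))\<^sup>2" for t
  have T: "T t = (\<Prod>j\<in>{1..n}. 1 + (poly c (x j))\<^sup>2)" if "?P t = root_poly {1..n} x" for t x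
    unfolding T_def that by (rule W) simp
  have "taylor_germ 2 e T"
  proof -
    have "poly (map_poly complex_of_real (?P t)) w = (\<Sum>i\<le>n. of_real (coeff (?P t) i) * w ^ i)" for t w
      by (simp add: poly_altdef degree_map_poly degree_signed_monic_poly coeff_map_poly)
    then show ?thesis
      unfolding T_def
      by (intro taylor_germ_cmod_prod_mset; simp;
          intro taylor_germ_sum taylor_germ_mult taylor_germ_const taylor_germ_coeff_signed_monic_poly tg)
  qed
  moreover have Te: "T e = 1" by (subst T[OF v]) (auto simp: c prod_zero_iff intro!: prod.neutral)
  have "\<forall>\<^sub>F t in at e. T e \<le> T t"
    using hyp
  proof eventually_elim
    case (elim t)
    then obtain x where "?P t = root_poly {1..n} x"
      using hyperbolic_imp_ordered_roots degree_signed_monic_poly by metis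
    then have "T t = (\<Prod>j\<in>{1..n}. 1 + (poly c (x j))\<^sup>2)" by (rule T)
    then show ?case unfolding Te by (auto intro: prod_ge_1)
  qed
  ultimately obtain K where K: "\<forall>\<^sub>F t in at e. T t - T e \<le> K * (t - e)\<^sup>2" by (rule taylor_germ_minimum)
  then have "\<forall>\<^sub>F t in at e. \<forall>x. ?P t = root_poly {1..n} x \<longrightarrow>
      (\<forall>j\<in>{1..n}. (\<Prod>w\<in>v ` {1..n}. x j - w)\<^sup>2 \<le> K * (t - e)\<^sup>2)"
  proof eventually_elim
    case (elim t)
    show ?case
    proof (intro allI impI ballI)
      fix x j assume x: "?P t = root_poly {1..n} x" and j: "j \<in> {1..n}"
      have "1 + (poly c (x j))\<^sup>2 = (1 + (poly c (x j))\<^sup>2) * 1" by simp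
      also have "\<dots> \<le> (1 + (poly c (x j))\<^sup>2) * (\<Prod>i\<in>{1..n} - {j}. 1 + (poly c (x i))\<^sup>2)"
        by (intro mult_left_mono prod_ge_1) auto
      also have "\<dots> = T t" unfolding T[OF x] using j by (simp add: prod.remove)
      finally show "(\<Prod>w\<in>v ` {1..n}. x j - w)\<^sup>2 \<le> K * (t - e)\<^sup>2" using elim Te unfolding c by simp
    qed
  qed
  then show thesis using that by blast
qed

text \<open>
  Cauchy's bound: solve the equation of \<open>x j\<close> for its leading term and divide by \<open>\<bar>x j\<bar> ^ (n - 1)\<close>, which
  dominates the lower powers once \<open>\<bar>x j\<bar> > 1\<close>.
\<close>

lemma root_bound:
  assumes "signed_monic_poly n c = root_poly {1..n} x" "j \<in> {1..n}"
  shows "\<bar>x j\<bar> \<le> 1 + (\<Sum>i=1..n. \<bar>c i\<bar>)"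
proof (cases "\<bar>x j\<bar> \<le> 1")
  case True
  then show ?thesis by (smt (verit) sum_nonneg abs_ge_zero)
next
  case False
  have n: "n \<ge> 1" using assms(2) by auto
  have "poly (signed_monic_poly n c) (x j) = 0"
    unfolding assms(1) poly_root_poly using assms(2) by (auto simp: prod_zero_iff)
  then have "x j ^ n = - (\<Sum>i=1..n. (-1) ^ i * c i * x j ^ (n - i))"
    unfolding poly_signed_monic_poly by linarith
  then have "\<bar>x j\<bar> ^ n = \<bar>\<Sum>i=1..n. (-1) ^ i * c i * x j ^ (n - i)\<bar>"
    by (simp flip: power_abs)
  also have "\<dots> \<le> (\<Sum>i=1..n. \<bar>(-1) ^ i * c i * x j ^ (n - i)\<bar>)" by (rule sum_abs)
  also have "\<dots> \<le> (\<Sum>i=1..n. \<bar>c i\<bar> * \<bar>x j\<bar> ^ (n - 1))"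
    using False by (intro sum_mono) (auto simp: abs_mult power_abs intro!: mult_left_mono power_increasing)
  finally have "\<bar>x j\<bar> * \<bar>x j\<bar> ^ (n - 1) \<le> (\<Sum>i=1..n. \<bar>c i\<bar>) * \<bar>x j\<bar> ^ (n - 1)"
    using n by (simp add: sum_distrib_right power_eq_if)
  moreover have "0 < \<bar>x j\<bar> ^ (n - 1)" using False by (intro zero_less_power) simp
  ultimately have "\<bar>x j\<bar> \<le> (\<Sum>i=1..n. \<bar>c i\<bar>)" by (simp only: mult_le_cancel_right_pos)
  then show ?thesis by simp
qed

text \<open>
  The trace of o-minimality on the behaviour of a function at a point.  Affine functions suffice to
  control the function itself as well as its difference quotients at that point.
\<close>

definition affine_comparable :: "real filter \<Rightarrow> (real \<Rightarrow> real) \<Rightarrow> bool" where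
  "affine_comparable F f \<longleftrightarrow> (\<forall>\<alpha> \<beta>. (\<forall>\<^sub>F t in F. f t < \<alpha> + \<beta> * t) \<or>
    (\<forall>\<^sub>F t in F. f t = \<alpha> + \<beta> * t) \<or> (\<forall>\<^sub>F t in F. f t > \<alpha> + \<beta> * t))"

lemma affine_comparable_cases:
  assumes "affine_comparable F f"
  shows "(\<forall>\<^sub>F t in F. f t \<le> \<alpha> + \<beta> * t) \<or> (\<forall>\<^sub>F t in F. \<alpha> + \<beta> * t \<le> f t)"
proof -
  consider "\<forall>\<^sub>F t in F. f t < \<alpha> + \<beta> * t" | "\<forall>\<^sub>F t in F. f t = \<alpha> + \<beta> * t" | "\<forall>\<^sub>F t in F. f t > \<alpha> + \<beta> * t"
    using assms by (auto simp: affine_comparable_def)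
  then show ?thesis
  proof cases
    case 1
    then have "\<forall>\<^sub>F t in F. f t \<le> \<alpha> + \<beta> * t" by eventually_elim simp
    then show ?thesis ..
  next
    case 2
    then have "\<forall>\<^sub>F t in F. f t \<le> \<alpha> + \<beta> * t" by eventually_elim simp
    then show ?thesis ..
  next
    case 3
    then have "\<forall>\<^sub>F t in F. \<alpha> + \<beta> * t \<le> f t" by eventually_elim simp
    then show ?thesis ..
  qed
qed

lemma affine_comparable_tendsto:
  assumes "affine_comparable F f" "F \<noteq> bot" "\<forall>\<^sub>F t in F. \<bar>f t\<bar> \<le> B"
  obtains v where "(f \<longlongrightarrow> v) F"
proof (rule tendsto_of_bounded_comparable[OF assms(2,3)])
  fix c
  show "(\<forall>\<^sub>F t in F. f t \<le> c) \<or> (\<forall>\<^sub>F t in F. c \<le> f t)"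
    using affine_comparable_cases[OF assms(1), of c 0] by simp
qed

lemma affine_comparable_quotient_tendsto:
  assumes "affine_comparable F f" "F \<noteq> bot" "\<forall>\<^sub>F t in F. \<bar>(f t - v) / (t - e)\<bar> \<le> B"
    and side: "(\<forall>\<^sub>F t in F. e < t) \<or> (\<forall>\<^sub>F t in F. t < e)"
  obtains L where "((\<lambda>t. (f t - v) / (t - e)) \<longlongrightarrow> L) F"
proof (rule tendsto_of_bounded_comparable[OF assms(2,3)])
  fix c
  have aff: "v - c * e + c * t = v + c * (t - e)" for t by (simp add: algebra_simps)
  have "(\<forall>\<^sub>F t in F. f t \<le> v + c * (t - e)) \<or> (\<forall>\<^sub>F t in F. v + c * (t - e) \<le> f t)"
    using affine_comparable_cases[OF assms(1), of "v - c * e" c] unfolding aff .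
  with side show "(\<forall>\<^sub>F t in F. (f t - v) / (t - e) \<le> c) \<or> (\<forall>\<^sub>F t in F. c \<le> (f t - v) / (t - e))"
  proof (elim disjE)
    assume "\<forall>\<^sub>F t in F. e < t" "\<forall>\<^sub>F t in F. f t \<le> v + c * (t - e)"
    then have "\<forall>\<^sub>F t in F. (f t - v) / (t - e) \<le> c" by eventually_elim (simp add: pos_divide_le_eq)
    then show ?thesis by simp
  next
    assume "\<forall>\<^sub>F t in F. e < t" "\<forall>\<^sub>F t in F. v + c * (t - e) \<le> f t"
    then have "\<forall>\<^sub>F t in F. c \<le> (f t - v) / (t - e)" by eventually_elim (simp add: pos_le_divide_eq)
    then show ?thesis by simp
  next
    assume "\<forall>\<^sub>F t in F. t < e" "\<forall>\<^sub>F t in F. f t \<le> v + c * (t - e)"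
    then have "\<forall>\<^sub>F t in F. c \<le> (f t - v) / (t - e)" by eventually_elim (simp add: neg_le_divide_eq)
    then show ?thesis by simp
  next
    assume "\<forall>\<^sub>F t in F. t < e" "\<forall>\<^sub>F t in F. v + c * (t - e) \<le> f t"
    then have "\<forall>\<^sub>F t in F. (f t - v) / (t - e) \<le> c" by eventually_elim (simp add: neg_divide_le_eq)
    then show ?thesis by simp
  qed
qed

text \<open>
  The filter \<open>F\<close> stands for one of the two sides of \<open>e\<close>.  Here \<open>v j\<close> is the limit of the \<open>j\<close>-th root and
  \<open>L j\<close> its one-sided speed at \<open>e\<close>.  The last conjunct recovers, from \<open>P\<close> alone, the speeds of all
  the roots that start at \<open>w\<close>: rescaling about \<open>w\<close> by \<open>t - e\<close> turns each factor \<open>w + (t - e) * y - l j t\<close> with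
  \<open>v j = w\<close> into \<open>t - e\<close> times a quantity tending to \<open>y - L j\<close>, while the other factors tend to \<open>w - v j\<close>.
\<close>

lemma onesided_root_expansion:
  fixes a l :: "nat \<Rightarrow> real \<Rightarrow> real"
  assumes "2 \<le> n" and tg: "\<And>j. j \<in> {1..n} \<Longrightarrow> taylor_germ 2 e (a j)"
    and hyp: "\<forall>\<^sub>F t in at e. hyperbolic (signed_monic_poly n (\<lambda>j. a j t))"
    and F: "F \<le> at e" "F \<noteq> bot" "(\<forall>\<^sub>F t in F. e < t) \<or> (\<forall>\<^sub>F t in F. t < e)"
    and fac: "\<forall>\<^sub>F t in F. signed_monic_poly n (\<lambda>j. a j t) = root_poly {1..n} (\<lambda>j. l j t)"
    and cmp: "\<And>j. j \<in> {1..n} \<Longrightarrow> affine_comparable F (l j)"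
  shows "\<exists>v L. (\<forall>j\<in>{1..n}. (l j \<longlongrightarrow> v j) F \<and> ((\<lambda>t. (l j t - v j) / (t - e)) \<longlongrightarrow> L j) F) \<and>
    signed_monic_poly n (\<lambda>j. a j e) = root_poly {1..n} v \<and>
    (\<forall>w y. ((\<lambda>t. poly (signed_monic_poly n (\<lambda>j. a j t)) (w + (t - e) * y) / (t - e) ^ card {j\<in>{1..n}. v j = w})
      \<longlongrightarrow> (\<Prod>j\<in>{j\<in>{1..n}. v j \<noteq> w}. w - v j) * poly (root_poly {j\<in>{1..n}. v j = w} L) y) F)"
proof -
  let ?P = "\<lambda>t. signed_monic_poly n (\<lambda>j. a j t)"
  have a: "(a j \<longlongrightarrow> a j e) F" if "j \<in> {1..n}" for j
    using tendsto_mono[OF F(1) taylor_germ_tendsto[OF tg[OF that]]] .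
  have "\<exists>v. (l j \<longlongrightarrow> v) F" if j: "j \<in> {1..n}" for j
  proof -
    have "((\<lambda>t. 1 + (\<Sum>i=1..n. \<bar>a i t\<bar>)) \<longlongrightarrow> 1 + (\<Sum>i=1..n. \<bar>a i e\<bar>)) F"
      by (intro tendsto_intros a)
    then have "\<forall>\<^sub>F t in F. 1 + (\<Sum>i=1..n. \<bar>a i t\<bar>) < 1 + (\<Sum>i=1..n. \<bar>a i e\<bar>) + 1"
      by (rule order_tendstoD) simp
    with fac have "\<forall>\<^sub>F t in F. \<bar>l j t\<bar> \<le> 1 + (\<Sum>i=1..n. \<bar>a i e\<bar>) + 1"
    proof eventually_elim
      case (elim t)
      then show ?case using root_bound[OF elim(1) j] by linarith
    qed
    then show ?thesis using affine_comparable_tendsto[OF cmp[OF j] F(2)] by metis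
  qed
  then obtain v where v: "\<And>j. j \<in> {1..n} \<Longrightarrow> (l j \<longlongrightarrow> v j) F" by metis
  have Pe: "?P e = root_poly {1..n} v"
  proof (rule poly_eqI_eval)
    fix x
    have lim: "((\<lambda>t. poly (?P t) x) \<longlongrightarrow> poly (?P e) x) F"
      unfolding poly_signed_monic_poly by (intro tendsto_intros a) auto
    have "((\<lambda>t. poly (root_poly {1..n} (\<lambda>j. l j t)) x) \<longlongrightarrow> poly (root_poly {1..n} v) x) F"
      unfolding poly_root_poly by (intro tendsto_intros v) auto
    moreover have "\<forall>\<^sub>F t in F. poly (root_poly {1..n} (\<lambda>j. l j t)) x = poly (?P t) x"
      using fac by eventually_elim simp
    ultimately have "((\<lambda>t. poly (?P t) x) \<longlongrightarrow> poly (root_poly {1..n} v) x) F"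
      by (rule Lim_transform_eventually)
    then show "poly (?P e) x = poly (root_poly {1..n} v) x"
      by (rule tendsto_unique[OF F(2) lim])
  qed
  obtain K where "\<forall>\<^sub>F t in at e. \<forall>x. ?P t = root_poly {1..n} x \<longrightarrow>
      (\<forall>j\<in>{1..n}. (\<Prod>w\<in>v ` {1..n}. x j - w)\<^sup>2 \<le> K * (t - e)\<^sup>2)"
    by (rule quadratic_bound_at_hyperbolic_point[OF \<open>2 \<le> n\<close> tg hyp Pe])
  then have K: "\<forall>\<^sub>F t in F. \<forall>x. ?P t = root_poly {1..n} x \<longrightarrow>
      (\<forall>j\<in>{1..n}. (\<Prod>w\<in>v ` {1..n}. x j - w)\<^sup>2 \<le> K * (t - e)\<^sup>2)"
    using F(1) filter_leD by blast
  have ne: "\<forall>\<^sub>F t in F. t \<noteq> e" using F(1) filter_leD eventually_neq_at_within by blast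
  have "\<exists>L. ((\<lambda>t. (l j t - v j) / (t - e)) \<longlongrightarrow> L) F" if j: "j \<in> {1..n}" for j
  proof -
    \<comment> \<open>the cofactor of \<open>x - v j\<close> in the product over the distinct roots of \<open>P e\<close>, hence nonzero at \<open>v j\<close>\<close>
    define d where "d x = (\<Prod>w\<in>v ` {1..n} - {v j}. x - w)" for x
    have d: "(\<Prod>w\<in>v ` {1..n}. x - w) = (x - v j) * d x" for x
      unfolding d_def using j by (intro prod.remove) auto
    have "d (v j) \<noteq> 0" by (auto simp: d_def prod_zero_iff)
    moreover have "((\<lambda>t. \<bar>d (l j t)\<bar>) \<longlongrightarrow> \<bar>d (v j)\<bar>) F"
      unfolding d_def by (intro tendsto_intros v j)
    ultimately have "\<forall>\<^sub>F t in F. \<bar>d (v j)\<bar> / 2 < \<bar>d (l j t)\<bar>" by (intro order_tendstoD) auto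
    with fac K ne have "\<forall>\<^sub>F t in F. \<bar>(l j t - v j) / (t - e)\<bar> \<le> sqrt K / (\<bar>d (v j)\<bar> / 2)"
    proof eventually_elim
      case (elim t)
      then have "((l j t - v j) * d (l j t))\<^sup>2 \<le> K * (t - e)\<^sup>2" using j d by auto
      then have "\<bar>l j t - v j\<bar> * \<bar>d (l j t)\<bar> \<le> sqrt K * \<bar>t - e\<bar>"
        by (metis abs_mult real_sqrt_abs real_sqrt_le_mono real_sqrt_mult)
      moreover have "\<bar>l j t - v j\<bar> * (\<bar>d (v j)\<bar> / 2) \<le> \<bar>l j t - v j\<bar> * \<bar>d (l j t)\<bar>"
        using elim by (intro mult_left_mono) auto
      ultimately have "\<bar>l j t - v j\<bar> * (\<bar>d (v j)\<bar> / 2) \<le> sqrt K * \<bar>t - e\<bar>" by linarith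
      then show ?case using elim \<open>d (v j) \<noteq> 0\<close>
        by (simp add: abs_divide divide_simps mult_ac)
    qed
    then show ?thesis using affine_comparable_quotient_tendsto[OF cmp[OF j] F(2) _ F(3)] by metis
  qed
  then obtain L where L: "\<And>j. j \<in> {1..n} \<Longrightarrow> ((\<lambda>t. (l j t - v j) / (t - e)) \<longlongrightarrow> L j) F" by metis
  have "((\<lambda>t. poly (?P t) (w + (t - e) * y) / (t - e) ^ card {j\<in>{1..n}. v j = w})
      \<longlongrightarrow> (\<Prod>j\<in>{j\<in>{1..n}. v j \<noteq> w}. w - v j) * poly (root_poly {j\<in>{1..n}. v j = w} L) y) F" for w y
  proof -
    let ?A = "{j\<in>{1..n}. v j = w}" and ?B = "{j\<in>{1..n}. v j \<noteq> w}"
    have te: "((\<lambda>t. t - e) \<longlongrightarrow> e - e) F"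
      by (intro tendsto_intros tendsto_mono[OF F(1) tendsto_ident_at])
    have "((\<lambda>t. (\<Prod>j\<in>?B. w + (t - e) * y - l j t) * (\<Prod>j\<in>?A. y - (l j t - v j) / (t - e)))
        \<longlongrightarrow> (\<Prod>j\<in>?B. w + (e - e) * y - v j) * (\<Prod>j\<in>?A. y - L j)) F"
      by (intro tendsto_intros te v L) auto
    moreover have "\<forall>\<^sub>F t in F. (\<Prod>j\<in>?B. w + (t - e) * y - l j t) * (\<Prod>j\<in>?A. y - (l j t - v j) / (t - e))
        = poly (?P t) (w + (t - e) * y) / (t - e) ^ card ?A"
      using fac ne
    proof eventually_elim
      case (elim t)
      have "poly (?P t) (w + (t - e) * y) = (\<Prod>j\<in>?B \<union> ?A. w + (t - e) * y - l j t)"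
        unfolding elim(1) poly_root_poly by (intro prod.cong) auto
      also have "\<dots> = (\<Prod>j\<in>?B. w + (t - e) * y - l j t) * (\<Prod>j\<in>?A. w + (t - e) * y - l j t)"
        by (intro prod.union_disjoint) auto
      also have "(\<Prod>j\<in>?A. w + (t - e) * y - l j t) = (\<Prod>j\<in>?A. (t - e) * (y - (l j t - v j) / (t - e)))"
        using elim(2) by (intro prod.cong) (auto simp: field_simps)
      also have "\<dots> = (t - e) ^ card ?A * (\<Prod>j\<in>?A. y - (l j t - v j) / (t - e))"
        by (simp add: prod.distrib)
      finally show ?case using elim(2) by simp
    qed
    ultimately show ?thesis unfolding poly_root_poly by (simp add: tendsto_cong)
  qed
  then show ?thesis using v L Pe by blast
qed

text \<open>
  The rescaled polynomials \<open>P t (w + (t - e) * y) / (t - e) ^ m\<close> have the same limit on both sides, because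
  the numerator has a Taylor expansion of order \<open>n \<ge> m\<close> at \<open>e\<close>.  So the speeds of the roots starting at \<open>w\<close>
  are the roots of the same polynomial in \<open>y\<close> on both sides.
\<close>

lemma onesided_root_expansions_match:
  fixes a l r :: "nat \<Rightarrow> real \<Rightarrow> real"
  assumes "2 \<le> n" and tg: "\<And>j. j \<in> {1..n} \<Longrightarrow> taylor_germ n e (a j)"
    and hyp: "\<forall>\<^sub>F t in at e. hyperbolic (signed_monic_poly n (\<lambda>j. a j t))"
    and facl: "\<forall>\<^sub>F t in at_left e. signed_monic_poly n (\<lambda>j. a j t) = root_poly {1..n} (\<lambda>j. l j t)"
    and cmpl: "\<And>j. j \<in> {1..n} \<Longrightarrow> affine_comparable (at_left e) (l j)"
    and facr: "\<forall>\<^sub>F t in at_right e. signed_monic_poly n (\<lambda>j. a j t) = root_poly {1..n} (\<lambda>j. r j t)"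
    and cmpr: "\<And>j. j \<in> {1..n} \<Longrightarrow> affine_comparable (at_right e) (r j)"
  shows "\<exists>v L s. s permutes {1..n} \<and> signed_monic_poly n (\<lambda>j. a j e) = root_poly {1..n} v \<and>
    (\<forall>j\<in>{1..n}. (l j \<longlongrightarrow> v j) (at_left e) \<and> (r (s j) \<longlongrightarrow> v j) (at_right e) \<and>
      ((\<lambda>t. (l j t - v j) / (t - e)) \<longlongrightarrow> L j) (at_left e) \<and>
      ((\<lambda>t. (r (s j) t - v j) / (t - e)) \<longlongrightarrow> L j) (at_right e))"
proof -
  let ?P = "\<lambda>t. signed_monic_poly n (\<lambda>j. a j t)"
  have tg2: "taylor_germ 2 e (a j)" if "j \<in> {1..n}" for j
    using taylor_germ_mono[OF tg[OF that] \<open>2 \<le> n\<close>] .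
  have left: "at_left e \<le> at e" "(\<forall>\<^sub>F t in at_left e. e < t) \<or> (\<forall>\<^sub>F t in at_left e. t < e)"
    and right: "at_right e \<le> at e" "(\<forall>\<^sub>F t in at_right e. e < t) \<or> (\<forall>\<^sub>F t in at_right e. t < e)"
    by (auto simp: eventually_at_filter at_le)
  obtain v L where v: "\<forall>j\<in>{1..n}. (l j \<longlongrightarrow> v j) (at_left e) \<and>
        ((\<lambda>t. (l j t - v j) / (t - e)) \<longlongrightarrow> L j) (at_left e)"
    and Pv: "?P e = root_poly {1..n} v"
    and liml: "\<forall>w y. ((\<lambda>t. poly (?P t) (w + (t - e) * y) / (t - e) ^ card {j\<in>{1..n}. v j = w})
      \<longlongrightarrow> (\<Prod>j\<in>{j\<in>{1..n}. v j \<noteq> w}. w - v j) * poly (root_poly {j\<in>{1..n}. v j = w} L) y) (at_left e)"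
    using onesided_root_expansion[OF \<open>2 \<le> n\<close> tg2 hyp left(1) trivial_limit_at_left_real left(2) facl cmpl]
    by blast
  obtain v' R where v': "\<forall>j\<in>{1..n}. (r j \<longlongrightarrow> v' j) (at_right e) \<and>
        ((\<lambda>t. (r j t - v' j) / (t - e)) \<longlongrightarrow> R j) (at_right e)"
    and Pv': "?P e = root_poly {1..n} v'"
    and limr: "\<forall>w y. ((\<lambda>t. poly (?P t) (w + (t - e) * y) / (t - e) ^ card {j\<in>{1..n}. v' j = w})
      \<longlongrightarrow> (\<Prod>j\<in>{j\<in>{1..n}. v' j \<noteq> w}. w - v' j) * poly (root_poly {j\<in>{1..n}. v' j = w} R) y) (at_right e)"
    using onesided_root_expansion[OF \<open>2 \<le> n\<close> tg2 hyp right(1) trivial_limit_at_right_real right(2) facr cmpr]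
    by blast
  have image: "image_mset v (mset_set {1..n}) = image_mset v' (mset_set {1..n})"
    using Pv Pv' by (intro root_poly_eq_imp_image_mset_eq) auto
  have same_roots: "root_poly {j\<in>{1..n}. v j = w} L = root_poly {j\<in>{1..n}. v' j = w} R" for w
  proof (rule poly_eqI_eval)
    fix y
    let ?m = "card {j\<in>{1..n}. v j = w}"
    \<comment> \<open>multiplicity and constant factor depend only on the multiset of the roots of \<open>P e\<close>\<close>
    have m: "card {j\<in>{1..n}. v' j = w} = ?m"
      using arg_cong[OF image, of "\<lambda>M. count M w"] by (simp add: count_image_mset' eq_commute[of w])
    have C: "(\<Prod>j\<in>{j\<in>{1..n}. u j \<noteq> w}. w - u j)
        = (\<Prod>z\<in>#filter_mset (\<lambda>z. z \<noteq> w) (image_mset u (mset_set {1..n})). w - z)" for u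
    proof -
      have "(\<Prod>j\<in>{j\<in>{1..n}. u j \<noteq> w}. w - u j) = (\<Prod>j\<in>#filter_mset (\<lambda>j. u j \<noteq> w) (mset_set {1..n}). w - u j)"
        by (simp add: prod_unfold_prod_mset)
      then show ?thesis by (simp add: filter_mset_image_mset multiset.map_comp comp_def)
    qed
    have nz: "(\<Prod>j\<in>{j\<in>{1..n}. v j \<noteq> w}. w - v j) \<noteq> 0" by (auto simp: prod_zero_iff)
    have "{j\<in>{1..n}. v j = w} \<subseteq> {1..n}" by auto
    from card_mono[OF finite_atLeastAtMost this] have "?m \<le> n" by simp
    moreover have "taylor_germ n e (\<lambda>t. poly (?P t) (w + (t - e) * y))"
    proof -
      have "taylor_germ n e (\<lambda>t. \<Sum>i\<le>n. coeff (?P t) i * poly [:w, y:] (t - e) ^ i)"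
        by (intro taylor_germ_sum taylor_germ_mult taylor_germ_power taylor_germ_poly
            taylor_germ_coeff_signed_monic_poly tg)
      then show ?thesis by (simp add: poly_altdef[of "?P _"] degree_signed_monic_poly mult.commute)
    qed
    ultimately have "taylor_germ ?m e (\<lambda>t. poly (?P t) (w + (t - e) * y))" by (rule taylor_germ_mono[rotated])
    then have "(\<Prod>j\<in>{j\<in>{1..n}. v' j \<noteq> w}. w - v' j) * poly (root_poly {j\<in>{1..n}. v' j = w} R) y
        = (\<Prod>j\<in>{j\<in>{1..n}. v j \<noteq> w}. w - v j) * poly (root_poly {j\<in>{1..n}. v j = w} L) y"
      by (rule taylor_germ_onesided_limits_eq[OF _ limr[rule_format, of w y, unfolded m] liml[rule_format]])
    then show "poly (root_poly {j\<in>{1..n}. v j = w} L) y = poly (root_poly {j\<in>{1..n}. v' j = w} R) y"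
      using nz unfolding C[of v] C[of v'] image by simp
  qed
  obtain s where s: "s permutes {1..n}" "\<And>j. j \<in> {1..n} \<Longrightarrow> v' (s j) = v j \<and> R (s j) = L j"
    using permutation_matching_pairs[OF finite_atLeastAtMost trans[OF Pv[symmetric] Pv'] same_roots] by blast
  have sj: "s j \<in> {1..n}" if "j \<in> {1..n}" for j using permutes_in_image[OF s(1)] that by blast
  have "\<forall>j\<in>{1..n}. (l j \<longlongrightarrow> v j) (at_left e) \<and> (r (s j) \<longlongrightarrow> v j) (at_right e) \<and>
      ((\<lambda>t. (l j t - v j) / (t - e)) \<longlongrightarrow> L j) (at_left e) \<and>
      ((\<lambda>t. (r (s j) t - v j) / (t - e)) \<longlongrightarrow> L j) (at_right e)"
  proof
    fix j assume j: "j \<in> {1..n}"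
    show "(l j \<longlongrightarrow> v j) (at_left e) \<and> (r (s j) \<longlongrightarrow> v j) (at_right e) \<and>
      ((\<lambda>t. (l j t - v j) / (t - e)) \<longlongrightarrow> L j) (at_left e) \<and>
      ((\<lambda>t. (r (s j) t - v j) / (t - e)) \<longlongrightarrow> L j) (at_right e)"
      using v[rule_format, OF j] v'[rule_format, OF sj[OF j]] s(2)[OF j] by simp
  qed
  then show ?thesis using s(1) Pv by blast
qed

section \<open>Definable predicates and functions\<close>

lemma real_poly_fun_mono: "real_poly_fun m f \<Longrightarrow> m \<le> n \<Longrightarrow> real_poly_fun n f"
  by (induction rule: real_poly_fun.induct) (auto intro: real_poly_fun.intros)

lemma real_poly_fun_append: "real_poly_fun n f \<Longrightarrow> length x = n \<Longrightarrow> f (x @ y) = f x"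
  by (induction rule: real_poly_fun.induct) (auto simp: nth_append)

lemma real_poly_fun_cmult: "real_poly_fun n f \<Longrightarrow> real_poly_fun n (\<lambda>x. c * f x)"
  by (intro real_poly_fun.intros)

lemma real_poly_fun_diff: "real_poly_fun n f \<Longrightarrow> real_poly_fun n g \<Longrightarrow> real_poly_fun n (\<lambda>x. f x - g x)"
  using real_poly_fun.add[OF _ real_poly_fun_cmult[of n g "-1"], of f] by simp

text \<open>
  The elementary symmetric functions, up to sign, as polynomial functions of the roots.
\<close>

lemma real_poly_fun_coeff_root_poly:
  assumes "finite A" "\<And>i. i \<in> A \<Longrightarrow> i < n"
  shows "real_poly_fun n (\<lambda>x. coeff (root_poly A (\<lambda>i. x ! i)) k)"
  using assms
proof (induction A arbitrary: k rule: finite_induct)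
  case empty
  show ?case by (simp add: root_poly_def real_poly_fun.const)
next
  case (insert i A)
  have r: "root_poly (insert i A) z = [:- z i, 1:] * root_poly A z" for z
    using insert by (simp add: root_poly_def)
  have "real_poly_fun n (\<lambda>x. (-1) * (x ! i) * coeff (root_poly A (\<lambda>i. x ! i)) k
      + (case k of 0 \<Rightarrow> 0 | Suc k' \<Rightarrow> coeff (root_poly A (\<lambda>i. x ! i)) k'))"
    using insert
    by (intro real_poly_fun.add real_poly_fun.mult real_poly_fun.const real_poly_fun.coord)
      (cases k; auto intro: real_poly_fun.const)+
  then show ?case unfolding r by (simp add: coeff_pCons algebra_simps cong: nat.case_cong)
qed

lemma nths_singleton: "k < length xs \<Longrightarrow> nths xs {k} = [xs ! k]"
proof (induction xs arbitrary: k)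
  case (Cons x xs)
  show ?case
  proof (cases k)
    case 0
    then show ?thesis by (simp add: nths_Cons)
  next
    case (Suc k')
    then have "{j. Suc j \<in> {k}} = {k'}" by auto
    then show ?thesis using Cons Suc by (simp add: nths_Cons)
  qed
qed simp

lemma nths_zero_and:
  assumes "0 < j" "j < length xs"
  shows "nths xs {0, j} = [xs ! 0, xs ! j]"
proof -
  obtain x ys where xs: "xs = x # ys" using assms by (cases xs) auto
  have "{i. Suc i \<in> {0, j}} = {j - 1}" using assms by auto
  then show ?thesis using assms nths_singleton[of "j - 1" ys] by (simp add: xs nths_Cons)
qed

text \<open>
  A frontier point \<open>x\<close> of the open interval \<open>J\<close> lies outside \<open>J\<close>, so \<open>J\<close> is entirely on one side of \<open>x\<close>.
\<close>

lemma finite_frontier_open_interval: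
  fixes J :: "real set"
  assumes "open J" "is_interval J"
  shows "finite (frontier J)"
proof -
  have "frontier J \<subseteq> {Inf J, Sup J}"
  proof
    fix x assume x: "x \<in> frontier J"
    then have cl: "x \<in> closure J" and "x \<notin> J" using assms(1) by (auto simp: frontier_def interior_open)
    then have ne: "J \<noteq> {}" by auto
    have "(\<forall>y\<in>J. y \<le> x) \<or> (\<forall>y\<in>J. x \<le> y)"
      using \<open>x \<notin> J\<close> assms(2) unfolding is_interval_1 by (meson linear)
    then show "x \<in> {Inf J, Sup J}"
    proof
      assume le: "\<forall>y\<in>J. y \<le> x"
      have "Sup J = x"
      proof (rule cSup_eq_non_empty[OF ne])
        fix b assume "\<And>y. y \<in> J \<Longrightarrow> y \<le> b"
        then have "closure J \<subseteq> {..b}" by (intro closure_minimal) auto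
        then show "x \<le> b" using cl by auto
      qed (use le in auto)
      then show ?thesis by simp
    next
      assume ge: "\<forall>y\<in>J. x \<le> y"
      have "Inf J = x"
      proof (rule cInf_eq_non_empty[OF ne])
        fix b assume "\<And>y. y \<in> J \<Longrightarrow> b \<le> y"
        then have "closure J \<subseteq> {b..}" by (intro closure_minimal) auto
        then show "b \<le> x" using cl by auto
      qed (use ge in auto)
      then show ?thesis by simp
    qed
  qed
  then show ?thesis using finite_subset by blast
qed

lemma finite_frontier_Union:
  assumes "finite F" "\<And>J. J \<in> F \<Longrightarrow> finite (frontier J)"
  shows "finite (frontier (\<Union>F))"
  using assms
proof (induction F rule: finite_induct)
  case (insert J F)
  have "frontier (J \<union> \<Union>F) \<subseteq> frontier J \<union> frontier (\<Union>F)" by (rule frontier_Un_subset)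
  then show ?case using insert finite_subset by fastforce
qed simp

lemma connected_avoiding_frontier:
  assumes "connected J" "J \<inter> frontier S = {}"
  shows "J \<subseteq> S \<or> J \<inter> S = {}"
  using connected_Int_frontier[OF assms(1), of S] assms(2) by blast

text \<open>
  A one-sided interval at \<open>e\<close> so short that it avoids the finite frontier is connected, hence inside
  \<open>S\<close> or disjoint from it.
\<close>

lemma finite_frontier_imp_decided:
  fixes S :: "real set"
  assumes "finite (frontier S)"
  shows "(\<forall>\<^sub>F t in at_right e. t \<in> S) \<or> (\<forall>\<^sub>F t in at_right e. t \<notin> S)"
    and "(\<forall>\<^sub>F t in at_left e. t \<in> S) \<or> (\<forall>\<^sub>F t in at_left e. t \<notin> S)"
proof -
  obtain d where d: "d > 0" "\<And>x. x \<in> frontier S \<Longrightarrow> x \<noteq> e \<Longrightarrow> d \<le> dist e x"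
    using finite_set_avoid[OF assms] by blast
  have R: "\<forall>\<^sub>F t in at_right e. t \<in> {e<..<e + d}" and L: "\<forall>\<^sub>F t in at_left e. t \<in> {e - d<..<e}"
    using d(1) eventually_at_right_less eventually_at_left_field[of _ e] eventually_at_right_field[of _ e]
    by (auto intro: exI[of _ "e + d"] exI[of _ "e - d"])
  have "{e<..<e + d} \<inter> frontier S = {}" "{e - d<..<e} \<inter> frontier S = {}"
    using d(2) by (force simp: dist_real_def)+
  then have "{e<..<e + d} \<subseteq> S \<or> {e<..<e + d} \<inter> S = {}" "{e - d<..<e} \<subseteq> S \<or> {e - d<..<e} \<inter> S = {}"
    by (intro connected_avoiding_frontier; simp)+
  then show "(\<forall>\<^sub>F t in at_right e. t \<in> S) \<or> (\<forall>\<^sub>F t in at_right e. t \<notin> S)"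
    "(\<forall>\<^sub>F t in at_left e. t \<in> S) \<or> (\<forall>\<^sub>F t in at_left e. t \<notin> S)"
    using eventually_mono[OF R, of "\<lambda>t. t \<in> S"] eventually_mono[OF R, of "\<lambda>t. t \<notin> S"]
      eventually_mono[OF L, of "\<lambda>t. t \<in> S"] eventually_mono[OF L, of "\<lambda>t. t \<notin> S"] by blast+
qed

definition graph_on :: "real set \<Rightarrow> (real \<Rightarrow> real) \<Rightarrow> real list set" where
  "graph_on S f = {[t, f t] | t. t \<in> S}"

lemma pair_in_graph_on [simp]: "[t, y] \<in> graph_on S f \<longleftrightarrow> t \<in> S \<and> y = f t"
  by (auto simp: graph_on_def)

context o_minimal_structure
begin

text \<open>
  Predicates instead of sets, so that definability can be read off the syntax of a formula.
\<close>

definition definable_pred :: "nat \<Rightarrow> (real list \<Rightarrow> bool) \<Rightarrow> bool" where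
  "definable_pred n P \<longleftrightarrow> {x. length x = n \<and> P x} \<in> M n"

lemma definable_pred_cong:
  "(\<And>x. length x = n \<Longrightarrow> P x \<longleftrightarrow> Q x) \<Longrightarrow> definable_pred n P \<longleftrightarrow> definable_pred n Q"
  by (simp add: definable_pred_def cong: conj_cong)

lemma definable_pred_zero: "1 \<le> n \<Longrightarrow> real_poly_fun n f \<Longrightarrow> definable_pred n (\<lambda>x. f x = 0)"
  using semialgebraic[of n f "{}"] by (simp add: definable_pred_def euclidean_lists_def)

lemma definable_pred_pos: "1 \<le> n \<Longrightarrow> real_poly_fun n f \<Longrightarrow> definable_pred n (\<lambda>x. f x > 0)"
  using semialgebraic[of n "\<lambda>x. 0" "{f}"]
  by (simp add: definable_pred_def euclidean_lists_def real_poly_fun.const)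

lemma definable_pred_True: "1 \<le> n \<Longrightarrow> definable_pred n (\<lambda>x. True)"
  using definable_pred_zero[of n "\<lambda>x. 0"] by (simp add: real_poly_fun.const)

lemma definable_pred_conj:
  assumes "1 \<le> n" "definable_pred n P" "definable_pred n Q"
  shows "definable_pred n (\<lambda>x. P x \<and> Q x)"
proof -
  have "{x. length x = n \<and> P x} \<inter> {x. length x = n \<and> Q x} = {x. length x = n \<and> P x \<and> Q x}" by auto
  then show ?thesis
    using intersection[OF assms(1) assms(2,3)[unfolded definable_pred_def]] by (simp add: definable_pred_def)
qed

lemma definable_pred_not:
  assumes "1 \<le> n" "definable_pred n P"
  shows "definable_pred n (\<lambda>x. \<not> P x)"
proof -
  have "euclidean_lists n - {x. length x = n \<and> P x} = {x. length x = n \<and> \<not> P x}"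
    by (auto simp: euclidean_lists_def)
  then show ?thesis
    using complement[OF assms(1) assms(2)[unfolded definable_pred_def]] by (simp add: definable_pred_def)
qed

lemma definable_pred_disj:
  "1 \<le> n \<Longrightarrow> definable_pred n P \<Longrightarrow> definable_pred n Q \<Longrightarrow> definable_pred n (\<lambda>x. P x \<or> Q x)"
  using definable_pred_not[OF _ definable_pred_conj[OF _ definable_pred_not definable_pred_not], of n P Q]
  by simp

lemma definable_pred_ball:
  "finite A \<Longrightarrow> 1 \<le> n \<Longrightarrow> (\<And>i. i \<in> A \<Longrightarrow> definable_pred n (P i)) \<Longrightarrow> definable_pred n (\<lambda>x. \<forall>i\<in>A. P i x)"
  by (induction A rule: finite_induct) (auto intro: definable_pred_True definable_pred_conj)

text \<open>
  Bound variables are always appended at the end of the list; quantifying them away is then the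
  projection onto an initial segment of the coordinates.
\<close>

lemma definable_pred_ex:
  assumes "1 \<le> n" "definable_pred (Suc n) P"
  shows "definable_pred n (\<lambda>x. \<exists>y. P (x @ [y]))"
proof -
  have "(\<lambda>z. nths z {..<n}) ` {z. length z = Suc n \<and> P z} = {x. length x = n \<and> (\<exists>y. P (x @ [y]))}"
  proof (intro equalityI subsetI)
    fix x assume "x \<in> {x. length x = n \<and> (\<exists>y. P (x @ [y]))}"
    then obtain y where "length x = n" "P (x @ [y])" by auto
    then show "x \<in> (\<lambda>z. nths z {..<n}) ` {z. length z = Suc n \<and> P z}"
      by (intro image_eqI[of _ _ "x @ [y]"]) auto
  next
    fix x assume "x \<in> (\<lambda>z. nths z {..<n}) ` {z. length z = Suc n \<and> P z}"
    then obtain z where z: "length z = Suc n" "P z" "x = take n z" by auto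
    then have "x @ [z ! n] = z" by (simp flip: take_Suc_conv_app_nth)
    then have "P (x @ [z ! n])" using z(2) by simp
    then show "x \<in> {x. length x = n \<and> (\<exists>y. P (x @ [y]))}" using z by auto
  qed
  then show ?thesis
    using projection[of "Suc n" "{z. length z = Suc n \<and> P z}" "{..<n}"] assms
    unfolding definable_pred_def by (auto simp: lessThan_empty_iff)
qed

text \<open>
  Substitution of polynomial terms into a definable binary relation \<open>A\<close>.  The condition is
  rewritten as the existence of two further coordinates which lie in \<open>A\<close> and equal \<open>f x\<close> and \<open>g x\<close>.
\<close>

lemma definable_pred_pair:
  assumes "1 \<le> n" "A \<in> M 2" "real_poly_fun n f" "real_poly_fun n g"
  shows "definable_pred n (\<lambda>x. [f x, g x] \<in> A)"
proof -
  let ?N = "Suc (Suc n)"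
  have E: "euclidean_lists n \<in> M n"
    using definable_pred_True[OF assms(1)] by (simp add: definable_pred_def euclidean_lists_def)
  have A2: "length y = 2" if "y \<in> A" for y using in_space[OF _ assms(2)] that by (auto simp: euclidean_lists_def)
  have "{x @ y | x y. x \<in> euclidean_lists n \<and> y \<in> A} \<in> M (n + 2)"
    using product[OF assms(1) _ E assms(2)] by simp
  moreover have "{x @ y | x y. x \<in> euclidean_lists n \<and> y \<in> A} = {z. length z = ?N \<and> drop n z \<in> A}"
  proof (intro equalityI subsetI)
    fix z assume z: "z \<in> {z. length z = ?N \<and> drop n z \<in> A}"
    then have "z = take n z @ drop n z \<and> take n z \<in> euclidean_lists n \<and> drop n z \<in> A"
      by (simp add: euclidean_lists_def)
    then show "z \<in> {x @ y | x y. x \<in> euclidean_lists n \<and> y \<in> A}" by blast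
  qed (use A2 in \<open>auto simp: euclidean_lists_def\<close>)
  ultimately have "definable_pred ?N (\<lambda>z. drop n z \<in> A)" by (simp add: definable_pred_def)
  moreover have "definable_pred ?N (\<lambda>z. f z - z ! n = 0)" "definable_pred ?N (\<lambda>z. g z - z ! Suc n = 0)"
    by (intro definable_pred_zero real_poly_fun_diff real_poly_fun.coord real_poly_fun_mono[OF assms(3)]
        real_poly_fun_mono[OF assms(4)]; simp)+
  ultimately have "definable_pred ?N (\<lambda>z. drop n z \<in> A \<and> f z - z ! n = 0 \<and> g z - z ! Suc n = 0)"
    by (intro definable_pred_conj) auto
  then have "definable_pred n (\<lambda>x. \<exists>u w. drop n ((x @ [u]) @ [w]) \<in> A \<and>
      f ((x @ [u]) @ [w]) - ((x @ [u]) @ [w]) ! n = 0 \<and> g ((x @ [u]) @ [w]) - ((x @ [u]) @ [w]) ! Suc n = 0)"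
    using assms(1) by (intro definable_pred_ex) auto
  then show ?thesis
    by (rule definable_pred_cong[THEN iffD1, rotated])
      (auto simp: real_poly_fun_append[OF assms(3)] real_poly_fun_append[OF assms(4)] nth_append)
qed

lemma interval_in_M:
  assumes "open J" "is_interval J"
  shows "(\<lambda>t. [t]) ` J \<in> M 1"
  unfolding tame using assms by (auto intro!: exI[of _ "{J}"])

lemma definable_pred_interval:
  assumes "1 \<le> n" "open J" "is_interval J" "real_poly_fun n f"
  shows "definable_pred n (\<lambda>x. f x \<in> J)"
proof -
  have "{x @ y | x y. x \<in> (\<lambda>t. [t]) ` J \<and> y \<in> (\<lambda>t. [t]) ` (UNIV :: real set)} \<in> M (1 + 1)"
    by (intro product interval_in_M assms(2,3)) auto
  moreover have "{x @ y | x y. x \<in> (\<lambda>t. [t]) ` J \<and> y \<in> (\<lambda>t. [t]) ` (UNIV :: real set)} = {[t, y] | t y. t \<in> J}"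
  proof (intro equalityI subsetI)
    fix z assume "z \<in> {[t, y] | t y. t \<in> J}"
    then obtain t y where "t \<in> J" "z = [t] @ [y]" by auto
    then show "z \<in> {x @ y | x y. x \<in> (\<lambda>t. [t]) ` J \<and> y \<in> (\<lambda>t. [t]) ` (UNIV :: real set)}" by blast
  qed auto
  ultimately have "{[t, y] | t y. t \<in> J} \<in> M 2" by (simp add: numeral_2_eq_2)
  from definable_pred_pair[OF assms(1) this assms(4) real_poly_fun.const[of n 0]]
  show ?thesis by simp
qed

text \<open>
  A finite union of open intervals and points has a finite frontier.  In this form tameness enters the
  analysis of functions at a point.
\<close>

lemma definable_pred_finite_frontier:
  assumes "definable_pred 1 P"
  shows "finite (frontier {t. P [t]})"
proof -
  obtain F where F: "finite F" "\<forall>J\<in>F. (open J \<and> is_interval J) \<or> (\<exists>c::real. J = {c})"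
    and eq: "{x. length x = 1 \<and> P x} = (\<lambda>t. [t]) ` \<Union>F"
    using assms unfolding definable_pred_def tame mem_Collect_eq by blast
  have "P [t] \<longleftrightarrow> t \<in> \<Union>F" for t
  proof -
    have "P [t] \<longleftrightarrow> [t] \<in> {x. length x = 1 \<and> P x}" by simp
    then show ?thesis unfolding eq by auto
  qed
  moreover have "finite (frontier (\<Union>F))"
  proof (rule finite_frontier_Union)
    fix J assume "J \<in> F"
    then consider "open J" "is_interval J" | c where "J = {c}" using F(2) by blast
    then show "finite (frontier J)"
    proof cases
      case 1
      then show ?thesis by (rule finite_frontier_open_interval)
    qed (simp add: frontier_def)
  qed (rule F(1))
  ultimately show ?thesis by (simp del: Union_iff)
qed

lemma definable_fun_on_iff: "definable_fun_on M S f \<longleftrightarrow> graph_on S f \<in> M 2"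
proof
  assume "definable_fun_on M S f"
  then obtain k where k: "1 \<le> k" "graph_on S f \<in> M k"
    unfolding definable_fun_on_def definable_def graph_on_def by auto
  show "graph_on S f \<in> M 2"
  proof (cases "S = {}")
    case True
    have "definable_pred 2 (\<lambda>x. \<not> True)" by (intro definable_pred_not definable_pred_True) auto
    then show ?thesis using True by (simp add: definable_pred_def graph_on_def)
  next
    case False
    then have "k = 2" using in_space[OF k] by (auto simp: euclidean_lists_def graph_on_def)
    then show ?thesis using k by simp
  qed
next
  assume "graph_on S f \<in> M 2"
  then show "definable_fun_on M S f"
    unfolding definable_fun_on_def definable_def graph_on_def by (intro exI[of _ 2]) auto
qed

lemma definable_fun_on_pred_iff:
  "definable_fun_on M S f \<longleftrightarrow> definable_pred 2 (\<lambda>x. [x ! 0, x ! 1] \<in> graph_on S f)"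
proof -
  have "{x. length x = 2 \<and> [x ! 0, x ! 1] \<in> graph_on S f} = graph_on S f"
    by (auto simp: length_Suc_conv numeral_2_eq_2 graph_on_def)
  then show ?thesis by (simp add: definable_fun_on_iff definable_pred_def)
qed

lemma definable_pred_graph:
  assumes "definable_fun_on M S f" "1 \<le> n" "real_poly_fun n g" "real_poly_fun n h"
  shows "definable_pred n (\<lambda>x. [g x, h x] \<in> graph_on S f)"
  using definable_pred_pair[OF assms(2) assms(1)[unfolded definable_fun_on_iff] assms(3,4)] .

lemma definable_fun_on_subset:
  assumes "definable_fun_on M S f" "open J" "is_interval J" "J \<subseteq> S"
  shows "definable_fun_on M J f"
proof -
  have "definable_pred 2 (\<lambda>x. [x ! 0, x ! 1] \<in> graph_on S f \<and> x ! 0 \<in> J)"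
    using assms(1) unfolding definable_fun_on_pred_iff
    by (intro definable_pred_conj definable_pred_interval assms(2,3) real_poly_fun.coord) auto
  then show ?thesis unfolding definable_fun_on_pred_iff
    by (rule definable_pred_cong[THEN iffD1, rotated]) (use assms(4) in auto)
qed

lemma definable_fun_on_glue:
  assumes "definable_fun_on M (J \<inter> {..<e}) f" "definable_fun_on M (J \<inter> {e<..}) g" "e \<in> J"
  shows "definable_fun_on M J (\<lambda>t. if t < e then f t else if t = e then v else g t)"
proof -
  have "definable_pred 2 (\<lambda>x. x ! 0 - e = 0 \<and> x ! 1 - v = 0)"
    by (intro definable_pred_conj definable_pred_zero real_poly_fun_diff real_poly_fun.coord real_poly_fun.const) auto
  with assms(1,2) have "definable_pred 2 (\<lambda>x. ([x ! 0, x ! 1] \<in> graph_on (J \<inter> {..<e}) f \<or>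
      [x ! 0, x ! 1] \<in> graph_on (J \<inter> {e<..}) g) \<or> (x ! 0 - e = 0 \<and> x ! 1 - v = 0))"
    unfolding definable_fun_on_pred_iff by (intro definable_pred_disj) auto
  then show ?thesis unfolding definable_fun_on_pred_iff
    by (rule definable_pred_cong[THEN iffD1, rotated]) (use assms(3) in auto)
qed

lemma definable_superlevel_finite_frontier:
  assumes "definable_fun_on M S f" "real_poly_fun 2 g"
  shows "finite (frontier {t. t \<in> S \<and> g [t, f t] > 0})"
proof -
  have "definable_pred 2 (\<lambda>x. [x ! 0, x ! 1] \<in> graph_on S f \<and> g x > 0)"
    using assms(1) unfolding definable_fun_on_pred_iff
    by (intro definable_pred_conj definable_pred_pos assms(2)) auto
  then have "definable_pred 1 (\<lambda>x. \<exists>y. [(x @ [y]) ! 0, (x @ [y]) ! 1] \<in> graph_on S f \<and> g (x @ [y]) > 0)"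
    by (intro definable_pred_ex) (auto simp: numeral_2_eq_2)
  from definable_pred_finite_frontier[OF this] show ?thesis by (simp add: conj_ac)
qed

lemma definable_imp_affine_comparable:
  assumes "definable_fun_on M S f" "F = at_left e \<or> F = at_right e" "\<forall>\<^sub>F t in F. t \<in> S"
  shows "affine_comparable F f"
  unfolding affine_comparable_def
proof (intro allI)
  fix \<alpha> \<beta> :: real
  have dec: "(\<forall>\<^sub>F t in F. g [t, f t] > 0) \<or> (\<forall>\<^sub>F t in F. \<not> g [t, f t] > 0)" if g: "real_poly_fun 2 g" for g
  proof -
    have "(\<forall>\<^sub>F t in F. t \<in> {t. t \<in> S \<and> g [t, f t] > 0}) \<or> (\<forall>\<^sub>F t in F. t \<notin> {t. t \<in> S \<and> g [t, f t] > 0})"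
      using finite_frontier_imp_decided[OF definable_superlevel_finite_frontier[OF assms(1) g], of e] assms(2) by auto
    then show ?thesis
    proof
      assume "\<forall>\<^sub>F t in F. t \<in> {t. t \<in> S \<and> g [t, f t] > 0}"
      then have "\<forall>\<^sub>F t in F. g [t, f t] > 0" by eventually_elim simp
      then show ?thesis ..
    next
      assume "\<forall>\<^sub>F t in F. t \<notin> {t. t \<in> S \<and> g [t, f t] > 0}"
      with assms(3) have "\<forall>\<^sub>F t in F. \<not> g [t, f t] > 0" by eventually_elim simp
      then show ?thesis ..
    qed
  qed
  have p: "real_poly_fun 2 (\<lambda>x. x ! 1 - (\<alpha> + \<beta> * x ! 0))" "real_poly_fun 2 (\<lambda>x. (\<alpha> + \<beta> * x ! 0) - x ! 1)"
    by (intro real_poly_fun_diff real_poly_fun.intros; simp)+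
  have gt: "(\<forall>\<^sub>F t in F. f t > \<alpha> + \<beta> * t) \<or> (\<forall>\<^sub>F t in F. \<not> f t > \<alpha> + \<beta> * t)"
    and lt: "(\<forall>\<^sub>F t in F. f t < \<alpha> + \<beta> * t) \<or> (\<forall>\<^sub>F t in F. \<not> f t < \<alpha> + \<beta> * t)"
    using dec[OF p(1)] dec[OF p(2)] by simp_all
  have "\<forall>\<^sub>F t in F. f t = \<alpha> + \<beta> * t" if "\<forall>\<^sub>F t in F. \<not> f t > \<alpha> + \<beta> * t" "\<forall>\<^sub>F t in F. \<not> f t < \<alpha> + \<beta> * t"
    using that by eventually_elim simp
  with gt lt show "(\<forall>\<^sub>F t in F. f t < \<alpha> + \<beta> * t) \<or> (\<forall>\<^sub>F t in F. f t = \<alpha> + \<beta> * t) \<or> (\<forall>\<^sub>F t in F. f t > \<alpha> + \<beta> * t)"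
    by blast
qed

text \<open>
  The set of points at which \<open>f\<close> grows locally to the right with slope at least \<open>c\<close>.  For differentiable
  \<open>f\<close> it lies between \<open>{t. D t > c}\<close> and \<open>{t. D t \<ge> c}\<close>, which makes it a substitute for the
  superlevel sets of the derivative that avoids the nested quantifiers of a limit.
\<close>

lemma definable_local_growth_finite_frontier:
  assumes "definable_fun_on M S f"
  shows "finite (frontier {t \<in> S. \<exists>\<delta>>0. \<forall>u\<in>S. t < u \<and> u < t + \<delta> \<longrightarrow> c * (u - t) \<le> f u - f t})"
proof -
  \<comment> \<open>the coordinates of \<open>x\<close> are \<open>t\<close>, \<open>f t\<close>, \<open>\<delta>\<close>, \<open>u\<close> and \<open>f u\<close>; \<open>P\<close> says that \<open>u\<close> violates the inequality\<close>
  define P where "P x \<longleftrightarrow> [x ! 3, x ! 4] \<in> graph_on S f \<and> x ! 3 - x ! 0 > 0 \<and>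
    x ! 0 + x ! 2 - x ! 3 > 0 \<and> c * (x ! 3 - x ! 0) - (x ! 4 - x ! 1) > 0" for x :: "real list"
  have "definable_pred 5 P"
    unfolding P_def
    by (intro definable_pred_conj definable_pred_graph[OF assms] definable_pred_pos real_poly_fun_diff
        real_poly_fun.intros) auto
  then have "definable_pred 3 (\<lambda>x. \<not> (\<exists>u w. P ((x @ [u]) @ [w])))"
    by (intro definable_pred_not definable_pred_ex) (auto simp: eval_nat_numeral)
  then have "definable_pred 3 (\<lambda>x. [x ! 0, x ! 1] \<in> graph_on S f \<and> x ! 2 > 0 \<and> \<not> (\<exists>u w. P ((x @ [u]) @ [w])))"
    by (intro definable_pred_conj definable_pred_graph[OF assms] definable_pred_pos real_poly_fun.coord) auto
  then have "definable_pred 1 (\<lambda>x. \<exists>y \<delta>. [((x @ [y]) @ [\<delta>]) ! 0, ((x @ [y]) @ [\<delta>]) ! 1] \<in> graph_on S f \<and>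
     ((x @ [y]) @ [\<delta>]) ! 2 > 0 \<and> \<not> (\<exists>u w. P ((((x @ [y]) @ [\<delta>]) @ [u]) @ [w])))"
    by (intro definable_pred_ex) (auto simp: eval_nat_numeral)
  from definable_pred_finite_frontier[OF this]
  have "finite (frontier {t. t \<in> S \<and> (\<exists>\<delta>>0. \<not> (\<exists>u. u \<in> S \<and> t < u \<and> u < t + \<delta> \<and> f u - f t < c * (u - t)))})"
    by (simp add: P_def eval_nat_numeral)
  then show ?thesis by (simp add: not_less) (smt (verit) Collect_cong not_less)
qed

text \<open>
  The tuples \<open>t # xs\<close> with \<open>t \<in> S\<close> and \<open>xs\<close> the increasing list of the roots of \<open>P t\<close> form a definable set,
  by Vieta's formulas.  Since an increasing list of roots is unique, the graph of the \<open>j\<close>-th root is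
  the projection of this set onto the coordinates \<open>0\<close> and \<open>j\<close>.
\<close>

lemma definable_ordered_roots:
  assumes n: "1 \<le> n" and a: "\<And>j. j \<in> {1..n} \<Longrightarrow> definable_fun_on M S (a j)"
    and l: "\<And>t. t \<in> S \<Longrightarrow> signed_monic_poly n (\<lambda>j. a j t) = root_poly {1..n} (\<lambda>j. l j t)"
    and mono: "\<And>t. t \<in> S \<Longrightarrow> mono_on {1..n} (\<lambda>j. l j t)" and j: "j \<in> {1..n}"
  shows "definable_fun_on M S (l j)"
proof -
  define Q where "Q x \<longleftrightarrow> (\<forall>j\<in>{1..n}.
      [x ! 0, (-1) ^ j * coeff (root_poly {1..n} (\<lambda>i. x ! i)) (n - j)] \<in> graph_on S (a j)) \<and>
    (\<forall>i\<in>{1..n}. \<forall>k\<in>{i..n}. \<not> x ! i - x ! k > 0)" for x :: "real list"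
  have "definable_pred (Suc n) Q"
    unfolding Q_def
    by (intro definable_pred_conj definable_pred_ball definable_pred_graph[OF a] definable_pred_not
        definable_pred_pos real_poly_fun_cmult real_poly_fun_coeff_root_poly real_poly_fun_diff real_poly_fun.coord)
      (use n in auto)
  then have "(\<lambda>x. nths x {0, j}) ` {x. length x = Suc n \<and> Q x} \<in> M (card {0, j})"
    unfolding definable_pred_def using j by (intro projection) auto
  moreover have "card {0, j} = 2" using j by auto
  moreover have "(\<lambda>x. nths x {0, j}) ` {x. length x = Suc n \<and> Q x} = graph_on S (l j)"
  proof (intro equalityI subsetI)
    fix y assume "y \<in> (\<lambda>x. nths x {0, j}) ` {x. length x = Suc n \<and> Q x}"
    then obtain x where x: "length x = Suc n" "Q x" "y = nths x {0, j}" by auto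
    have t: "x ! 0 \<in> S" using x(2) n by (auto simp: Q_def)
    have "signed_monic_poly n (\<lambda>j. a j (x ! 0)) = root_poly {1..n} (\<lambda>i. x ! i)"
      using x(2) unfolding signed_monic_poly_eq_root_poly_iff Q_def by auto
    then have "image_mset (\<lambda>i. x ! i) (mset_set {1..n}) = image_mset (\<lambda>i. l i (x ! 0)) (mset_set {1..n})"
      using l[OF t] by (intro root_poly_eq_imp_image_mset_eq) auto
    moreover have "mono_on {1..n} (\<lambda>i. x ! i)" using x(2) by (auto simp: Q_def mono_on_def not_less)
    ultimately have "x ! j = l j (x ! 0)" using mono[OF t] j by (intro mono_on_eq_of_image_mset_eq)
    then show "y \<in> graph_on S (l j)" using t x j by (simp add: nths_zero_and)
  next
    fix y assume "y \<in> graph_on S (l j)"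
    then obtain t where t: "t \<in> S" "y = [t, l j t]" by (auto simp: graph_on_def)
    define x where "x = t # map (\<lambda>i. l i t) [1..<Suc n]"
    have x: "length x = Suc n" "x ! 0 = t" "\<And>i. i \<in> {1..n} \<Longrightarrow> x ! i = l i t"
      by (auto simp: x_def nth_Cons' simp del: upt_Suc)
    have "root_poly {1..n} (\<lambda>i. x ! i) = root_poly {1..n} (\<lambda>i. l i t)"
      unfolding root_poly_def using x(3) by (intro prod.cong) auto
    then have "Q x"
      using l[OF t(1)] mono[OF t(1)] t(1) x unfolding signed_monic_poly_eq_root_poly_iff Q_def mono_on_def
      by (auto simp: not_less)
    moreover have "y = nths x {0, j}" using j x t by (simp add: nths_zero_and)
    ultimately show "y \<in> (\<lambda>x. nths x {0, j}) ` {x. length x = Suc n \<and> Q x}" using x by auto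
  qed
  ultimately show ?thesis by (simp add: definable_fun_on_iff)
qed

end


section \<open>Derivatives of definable functions\<close>

text \<open>
  A one-sided difference quotient at \<open>e\<close> is a value of the derivative at a point closer to \<open>e\<close>, so it
  inherits every property that the derivative has eventually on that side.
\<close>

lemma eventually_mean_value:
  fixes f :: "real \<Rightarrow> real"
  assumes "open S" "e \<in> S" "\<And>x. x \<in> S \<Longrightarrow> (f has_real_derivative D x) (at x)"
    and F: "F = at_left e \<or> F = at_right e" and P: "\<forall>\<^sub>F t in F. P (D t)"
  shows "\<forall>\<^sub>F t in F. P ((f t - f e) / (t - e))"
proof -
  obtain r where r: "r > 0" "ball e r \<subseteq> S" using assms(1,2) open_contains_ball by blast
  have D: "x \<in> ball e r \<Longrightarrow> (f has_real_derivative D x) (at x)" for x using assms(3) r(2) by blast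
  from F show ?thesis
  proof
    assume F: "F = at_right e"
    then obtain b where b: "b > e" "\<And>t. e < t \<Longrightarrow> t < b \<Longrightarrow> P (D t)"
      using P by (auto simp: eventually_at_right_field)
    have "P ((f t - f e) / (t - e))" if t: "e < t" "t < min b (e + r)" for t
    proof -
      have "\<exists>z. e < z \<and> z < t \<and> f t - f e = (t - e) * D z"
        using t by (intro MVT2 D) (auto simp: dist_real_def)
      then obtain z where z: "e < z" "z < t" "f t - f e = (t - e) * D z" by blast
      then show ?thesis using b(2)[of z] t by simp
    qed
    then show ?thesis unfolding F eventually_at_right_field using b(1) r(1) by (intro exI[of _ "min b (e + r)"]) auto
  next
    assume F: "F = at_left e"
    then obtain b where b: "b < e" "\<And>t. b < t \<Longrightarrow> t < e \<Longrightarrow> P (D t)"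
      using P by (auto simp: eventually_at_left_field)
    have "P ((f t - f e) / (t - e))" if t: "max b (e - r) < t" "t < e" for t
    proof -
      have "\<exists>z. t < z \<and> z < e \<and> f e - f t = (e - t) * D z"
        using t by (intro MVT2 D) (auto simp: dist_real_def)
      then obtain z where z: "t < z" "z < e" "f e - f t = (e - t) * D z" by blast
      then have "(f t - f e) / (t - e) = D z" using t by (simp add: field_simps)
      then show ?thesis using b(2)[of z] z t by simp
    qed
    then show ?thesis unfolding F eventually_at_left_field using b(1) r(1) by (intro exI[of _ "max b (e - r)"]) auto
  qed
qed

text \<open>
  The derivative \<open>D\<close> is compared with a constant \<open>c\<close> on one side of a point \<open>e\<close>: by tameness of \<open>B c\<close>, either
  \<open>D \<ge> c\<close> eventually or \<open>D \<le> c\<close> eventually, and by the mean value theorem \<open>D e\<close> satisfies the same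
  inequality.  So a constant strictly above \<open>D e\<close> is eventually an upper bound of \<open>D\<close>, and a
  constant strictly below a lower bound, which is the continuity of \<open>D\<close>.
\<close>

lemma (in o_minimal_structure) definable_differentiable_imp_C1:
  assumes "open S" and der: "\<And>x. x \<in> S \<Longrightarrow> (f has_real_derivative D x) (at x)"
    and def: "definable_fun_on M S f"
  shows "f C1_differentiable_on S"
proof -
  define B where "B c = {t \<in> S. \<exists>\<delta>>0. \<forall>u\<in>S. t < u \<and> u < t + \<delta> \<longrightarrow> c * (u - t) \<le> f u - f t}" for c
  have slope: "((\<lambda>u. (f u - f t) / (u - t)) \<longlongrightarrow> D t) (at t)" if "t \<in> S" for t
    using der[OF that] by (simp add: has_field_derivative_iff)
  have B_imp: "c \<le> D t" if tB: "t \<in> B c" for c t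
  proof (rule tendsto_lowerbound)
    have t: "t \<in> S" using that by (simp add: B_def)
    show "((\<lambda>u. (f u - f t) / (u - t)) \<longlongrightarrow> D t) (at_right t)"
      using slope[OF t] by (simp add: filterlim_at_split)
    obtain \<delta> where \<delta>: "\<delta> > 0" "\<forall>u\<in>S. t < u \<and> u < t + \<delta> \<longrightarrow> c * (u - t) \<le> f u - f t"
      using tB unfolding B_def by blast
    have "\<forall>\<^sub>F u in at_right t. u \<in> S"
      using eventually_at_in_open'[OF assms(1) t] by (simp add: eventually_at_split)
    moreover have "\<forall>\<^sub>F u in at_right t. t < u" by (rule eventually_at_right_less)
    moreover have "\<forall>\<^sub>F u in at_right t. u < t + \<delta>"
      unfolding eventually_at_right_field using \<delta>(1) by (intro exI[of _ "t + \<delta>"]) auto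
    ultimately show "\<forall>\<^sub>F u in at_right t. c \<le> (f u - f t) / (u - t)"
      by eventually_elim (simp add: \<delta>(2) pos_le_divide_eq)
  qed simp
  have imp_B: "t \<in> B c" if t: "t \<in> S" and "c < D t" for c t
  proof -
    have "\<forall>\<^sub>F u in at t. c < (f u - f t) / (u - t)" using order_tendstoD(1)[OF slope[OF t] that(2)] .
    then obtain b where "b > t" "\<And>u. t < u \<Longrightarrow> u < b \<Longrightarrow> c < (f u - f t) / (u - t)"
      unfolding eventually_at_split eventually_at_right_field by auto
    then have "\<forall>u\<in>S. t < u \<and> u < t + (b - t) \<longrightarrow> c * (u - t) \<le> f u - f t" "b - t > 0"
      by (auto simp: pos_less_divide_eq less_imp_le)
    then show ?thesis using t unfolding B_def by blast
  qed
  have "(D \<longlongrightarrow> D e) F" if e: "e \<in> S" and F: "F = at_left e \<or> F = at_right e" for e F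
  proof -
    have dec: "(\<forall>\<^sub>F t in F. t \<in> B c) \<or> (\<forall>\<^sub>F t in F. t \<notin> B c)" for c
      using finite_frontier_imp_decided[OF definable_local_growth_finite_frontier[OF def, of c], of e] F
      unfolding B_def by auto
    have S: "\<forall>\<^sub>F t in F. t \<in> S"
      using eventually_at_in_open'[OF assms(1) e] F by (auto simp: eventually_at_split)
    have F': "F \<noteq> bot" "((\<lambda>t. (f t - f e) / (t - e)) \<longlongrightarrow> D e) F"
      using F slope[OF e] by (elim disjE; simp add: filterlim_at_split)+
    have lower: "c \<le> D e" if "\<forall>\<^sub>F t in F. c \<le> D t" for c
      by (rule tendsto_lowerbound[OF F'(2) eventually_mean_value[OF assms(1) e der F that] F'(1)])
    have upper: "D e \<le> c" if "\<forall>\<^sub>F t in F. D t \<le> c" for c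
      by (rule tendsto_upperbound[OF F'(2) eventually_mean_value[OF assms(1) e der F that] F'(1)])
    show ?thesis
    proof (rule order_tendstoI)
      fix c assume "D e < c"
      then obtain c' where c': "D e < c'" "c' < c" using dense by blast
      have "\<not> (\<forall>\<^sub>F t in F. t \<in> B c')"
      proof
        assume "\<forall>\<^sub>F t in F. t \<in> B c'"
        then have "\<forall>\<^sub>F t in F. c' \<le> D t" by eventually_elim (rule B_imp)
        then show False using lower[of c'] c' by simp
      qed
      then have "\<forall>\<^sub>F t in F. t \<notin> B c'" using dec[of c'] by simp
      with S show "\<forall>\<^sub>F t in F. D t < c" by eventually_elim (use imp_B[of _ c'] c' in force)
    next
      fix c assume "c < D e"
      then obtain c' where c': "c < c'" "c' < D e" using dense by blast
      have "\<not> (\<forall>\<^sub>F t in F. t \<notin> B c')"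
      proof
        assume "\<forall>\<^sub>F t in F. t \<notin> B c'"
        with S have "\<forall>\<^sub>F t in F. D t \<le> c'" by eventually_elim (use imp_B[of _ c'] in force)
        then show False using upper[of c'] c' by simp
      qed
      then have "\<forall>\<^sub>F t in F. t \<in> B c'" using dec[of c'] by simp
      then show "\<forall>\<^sub>F t in F. c < D t" by eventually_elim (use B_imp[of _ c'] c' in force)
    qed
  qed
  then have "continuous_on S D"
    using assms(1) by (simp add: continuous_on_eq_continuous_at isCont_def filterlim_at_split)
  then show ?thesis
    unfolding C1_differentiable_on_def using der by (auto simp: has_real_derivative_iff_has_vector_derivative)
qed

section \<open>Gluing parametrizations of the roots\<close>

lemma root_poly_permute:
  assumes "s permutes A"
  shows "root_poly A (\<lambda>j. x (s j)) = root_poly A x"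
  unfolding root_poly_def using prod.permute[OF assms, of "\<lambda>j. [:- x j, 1:]"] by (simp add: comp_def)

lemma has_real_derivative_split:
  assumes "((\<lambda>t. (f t - f e) / (t - e)) \<longlongrightarrow> L) (at_left e)" "((\<lambda>t. (f t - f e) / (t - e)) \<longlongrightarrow> L) (at_right e)"
  shows "(f has_real_derivative L) (at e)"
  using assms by (simp add: has_field_derivative_iff filterlim_at_split)

context o_minimal_structure
begin

definition root_parametrization :: "nat \<Rightarrow> (nat \<Rightarrow> real \<Rightarrow> real) \<Rightarrow> real set \<Rightarrow> (nat \<Rightarrow> real \<Rightarrow> real) \<Rightarrow> bool" where
  "root_parametrization n a J l \<longleftrightarrow> (\<forall>j\<in>{1..n}. definable_fun_on M J (l j)) \<and>
    (\<forall>t\<in>J. signed_monic_poly n (\<lambda>j. a j t) = root_poly {1..n} (\<lambda>j. l j t))"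

lemma root_parametrizations_match:
  assumes "2 \<le> n" "open I" "e \<in> I"
    and a: "\<And>j. j \<in> {1..n} \<Longrightarrow> Ck_on n (a j) I"
    and hyp: "\<And>t. t \<in> I \<Longrightarrow> hyperbolic (signed_monic_poly n (\<lambda>j. a j t))"
    and l: "root_parametrization n a J l" "\<forall>\<^sub>F t in at_left e. t \<in> J"
    and r: "root_parametrization n a K r" "\<forall>\<^sub>F t in at_right e. t \<in> K"
  shows "\<exists>v L s. s permutes {1..n} \<and> signed_monic_poly n (\<lambda>j. a j e) = root_poly {1..n} v \<and>
    (\<forall>j\<in>{1..n}. (l j \<longlongrightarrow> v j) (at_left e) \<and> (r (s j) \<longlongrightarrow> v j) (at_right e) \<and>
      ((\<lambda>t. (l j t - v j) / (t - e)) \<longlongrightarrow> L j) (at_left e) \<and>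
      ((\<lambda>t. (r (s j) t - v j) / (t - e)) \<longlongrightarrow> L j) (at_right e))"
proof (rule onesided_root_expansions_match[OF assms(1)])
  show "taylor_germ n e (a j)" if "j \<in> {1..n}" for j
    using Ck_on_imp_taylor_germ[OF assms(2,3) a[OF that]] .
  show "\<forall>\<^sub>F t in at e. hyperbolic (signed_monic_poly n (\<lambda>j. a j t))"
    using eventually_at_in_open'[OF assms(2,3)] by eventually_elim (rule hyp)
  show "\<forall>\<^sub>F t in at_left e. signed_monic_poly n (\<lambda>j. a j t) = root_poly {1..n} (\<lambda>j. l j t)"
    using l(2) by eventually_elim (use l(1) in \<open>simp add: root_parametrization_def\<close>)
  show "\<forall>\<^sub>F t in at_right e. signed_monic_poly n (\<lambda>j. a j t) = root_poly {1..n} (\<lambda>j. r j t)"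
    using r(2) by eventually_elim (use r(1) in \<open>simp add: root_parametrization_def\<close>)
  show "affine_comparable (at_left e) (l j)" if "j \<in> {1..n}" for j
    using l that by (intro definable_imp_affine_comparable[of J _ _ e]) (auto simp: root_parametrization_def)
  show "affine_comparable (at_right e) (r j)" if "j \<in> {1..n}" for j
    using r that by (intro definable_imp_affine_comparable[of K _ _ e]) (auto simp: root_parametrization_def)
qed

text \<open>
  Matching the ordered roots on the two sides of \<open>e\<close> gives a permutation \<open>s\<close> for which the left speed of
  the \<open>j\<close>-th root is the right speed of the \<open>s j\<close>-th one.  Both roots have the same value at \<open>e\<close>; roots
  with the same value at \<open>e\<close> agree on all of \<open>J\<close>, so the \<open>s j\<close>-th root is the \<open>j\<close>-th one.
\<close>

lemma ordered_roots_differentiable: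
  assumes "2 \<le> n" "open J" "is_interval J" "e \<in> J"
    and a: "\<And>j. j \<in> {1..n} \<Longrightarrow> Ck_on n (a j) J"
    and hyp: "\<And>t. t \<in> J \<Longrightarrow> hyperbolic (signed_monic_poly n (\<lambda>j. a j t))"
    and l: "root_parametrization n a J l"
    and mono: "\<And>t. t \<in> J \<Longrightarrow> mono_on {1..n} (\<lambda>j. l j t)"
    and pattern: "\<And>i k t. i \<in> {1..n} \<Longrightarrow> k \<in> {1..n} \<Longrightarrow> t \<in> J \<Longrightarrow> l i e = l k e \<Longrightarrow> l i t = l k t"
    and j: "j \<in> {1..n}"
  shows "\<exists>D. (l j has_real_derivative D) (at e)"
proof -
  have J: "\<forall>\<^sub>F t in at_left e. t \<in> J" "\<forall>\<^sub>F t in at_right e. t \<in> J"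
    using eventually_at_in_open'[OF assms(2,4)] by (simp_all add: eventually_at_split)
  obtain v L s where s: "s permutes {1..n}" and Pe: "signed_monic_poly n (\<lambda>j. a j e) = root_poly {1..n} v"
    and lim: "\<forall>j\<in>{1..n}. (l j \<longlongrightarrow> v j) (at_left e) \<and> (l (s j) \<longlongrightarrow> v j) (at_right e) \<and>
      ((\<lambda>t. (l j t - v j) / (t - e)) \<longlongrightarrow> L j) (at_left e) \<and>
      ((\<lambda>t. (l (s j) t - v j) / (t - e)) \<longlongrightarrow> L j) (at_right e)"
    using root_parametrizations_match[OF assms(1,2,4) a hyp l J(1) l J(2)] by blast
  \<comment> \<open>limits of ordered roots are ordered roots of the limit polynomial, so the ordered roots are continuous\<close>
  have limit_eq: "u i = l i e" if u: "\<And>i. i \<in> {1..n} \<Longrightarrow> (l i \<longlongrightarrow> u i) F"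
    and F: "F \<noteq> bot" "\<forall>\<^sub>F t in F. t \<in> J"
    and Pu: "signed_monic_poly n (\<lambda>j. a j e) = root_poly {1..n} u" and i: "i \<in> {1..n}" for u i F
  proof (rule mono_on_eq_of_image_mset_eq[OF _ mono[OF assms(4)] _ i])
    show "mono_on {1..n} u"
    proof (rule mono_onI)
      fix i k assume ik: "i \<in> {1..n}" "k \<in> {1..n}" "i \<le> k"
      have "\<forall>\<^sub>F t in F. l i t \<le> l k t"
        using F(2) by eventually_elim (use mono ik in \<open>auto simp: mono_on_def\<close>)
      then show "u i \<le> u k" using tendsto_le[OF F(1) u[OF ik(2)] u[OF ik(1)]] by blast
    qed
    show "image_mset u (mset_set {1..n}) = image_mset (\<lambda>j. l j e) (mset_set {1..n})"
      using Pu l assms(4) by (intro root_poly_eq_imp_image_mset_eq) (auto simp: root_parametrization_def)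
  qed
  have sj: "s j \<in> {1..n}" using permutes_in_image[OF s] j by blast
  have vj: "v j = l j e"
    using lim J(1) Pe j by (intro limit_eq[of v "at_left e"]) auto
  have "v (inv s (s j)) = l (s j) e"
  proof (rule limit_eq[of "\<lambda>i. v (inv s i)" "at_right e"])
    fix i assume "i \<in> {1..n}"
    then have "inv s i \<in> {1..n}" "s (inv s i) = i"
      using permutes_in_image[OF permutes_inv[OF s]] permutes_inverses(1)[OF s] by blast+
    then show "(l i \<longlongrightarrow> v (inv s i)) (at_right e)" using lim by metis
  next
    show "signed_monic_poly n (\<lambda>j. a j e) = root_poly {1..n} (\<lambda>i. v (inv s i))"
      unfolding Pe by (rule root_poly_permute[OF permutes_inv[OF s], symmetric])
  qed (use J(2) sj in auto)
  then have "l j e = l (s j) e" using vj permutes_inverses(2)[OF s] by simp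
  then have same: "l j t = l (s j) t" if "t \<in> J" for t using pattern j sj that by blast
  have "(l j has_real_derivative L j) (at e)"
  proof (rule has_real_derivative_split)
    show "((\<lambda>t. (l j t - l j e) / (t - e)) \<longlongrightarrow> L j) (at_left e)" using lim j vj by metis
    have "((\<lambda>t. (l (s j) t - l j e) / (t - e)) \<longlongrightarrow> L j) (at_right e)" using lim j vj by metis
    then show "((\<lambda>t. (l j t - l j e) / (t - e)) \<longlongrightarrow> L j) (at_right e)"
      by (rule Lim_transform_eventually) (use J(2) in \<open>eventually_elim, simp add: same\<close>)
  qed
  then show ?thesis ..
qed

lemma finite_frontier_equalizer:
  assumes "definable_fun_on M S f" "definable_fun_on M S g"
  shows "finite (frontier {t \<in> S. f t = g t})"
proof -
  have "definable_pred 2 (\<lambda>x. [x ! 0, x ! 1] \<in> graph_on S f \<and> [x ! 0, x ! 1] \<in> graph_on S g)"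
    using assms unfolding definable_fun_on_pred_iff by (intro definable_pred_conj) auto
  then have "definable_pred 1 (\<lambda>x. \<exists>y. [(x @ [y]) ! 0, (x @ [y]) ! 1] \<in> graph_on S f \<and>
      [(x @ [y]) ! 0, (x @ [y]) ! 1] \<in> graph_on S g)"
    by (intro definable_pred_ex) (auto simp: numeral_2_eq_2)
  from definable_pred_finite_frontier[OF this] show ?thesis
    by (rule back_subst[of "\<lambda>A. finite (frontier A)"]) auto
qed

definition differentiable_root_parametrization ::
    "nat \<Rightarrow> (nat \<Rightarrow> real \<Rightarrow> real) \<Rightarrow> real set \<Rightarrow> (nat \<Rightarrow> real \<Rightarrow> real) \<Rightarrow> bool" where
  "differentiable_root_parametrization n a J l \<longleftrightarrow> root_parametrization n a J l \<and>
    (\<forall>j\<in>{1..n}. \<forall>t\<in>J. \<exists>D. (l j has_real_derivative D) (at t))"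

text \<open>
  To the right of \<open>e\<close> the roots are renumbered by the permutation that matches values and speeds at \<open>e\<close>.
\<close>

lemma glue_differentiable_root_parametrizations:
  assumes "2 \<le> n" "open J" "e \<in> J"
    and a: "\<And>j. j \<in> {1..n} \<Longrightarrow> Ck_on n (a j) J"
    and hyp: "\<And>t. t \<in> J \<Longrightarrow> hyperbolic (signed_monic_poly n (\<lambda>j. a j t))"
    and l: "differentiable_root_parametrization n a (J \<inter> {..<e}) l"
    and r: "differentiable_root_parametrization n a (J \<inter> {e<..}) r"
  shows "\<exists>f. differentiable_root_parametrization n a J f"
proof -
  have "\<forall>\<^sub>F t in at_left e. t \<in> J" "\<forall>\<^sub>F t in at_right e. t \<in> J"
    using eventually_at_in_open'[OF assms(2,3)] by (simp_all add: eventually_at_split)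
  moreover have lt: "\<forall>\<^sub>F t in at_left e. t < e" and gt: "\<forall>\<^sub>F t in at_right e. e < t"
    by (auto simp: eventually_at_filter)
  ultimately have ev: "\<forall>\<^sub>F t in at_left e. t \<in> J \<inter> {..<e}" "\<forall>\<^sub>F t in at_right e. t \<in> J \<inter> {e<..}"
    by (auto elim: eventually_elim2)
  have lr: "root_parametrization n a (J \<inter> {..<e}) l" "root_parametrization n a (J \<inter> {e<..}) r"
    using l r by (auto simp: differentiable_root_parametrization_def)
  obtain v L s where s: "s permutes {1..n}" and Pe: "signed_monic_poly n (\<lambda>j. a j e) = root_poly {1..n} v"
    and lim: "\<forall>j\<in>{1..n}. (l j \<longlongrightarrow> v j) (at_left e) \<and> (r (s j) \<longlongrightarrow> v j) (at_right e) \<and>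
      ((\<lambda>t. (l j t - v j) / (t - e)) \<longlongrightarrow> L j) (at_left e) \<and>
      ((\<lambda>t. (r (s j) t - v j) / (t - e)) \<longlongrightarrow> L j) (at_right e)"
    using root_parametrizations_match[OF assms(1,2,3) a hyp lr(1) ev(1) lr(2) ev(2)] by blast
  have sj: "s j \<in> {1..n}" if "j \<in> {1..n}" for j using permutes_in_image[OF s] that by blast
  define f where "f j t = (if t < e then l j t else if t = e then v j else r (s j) t)" for j t
  have "definable_fun_on M J (f j)" if j: "j \<in> {1..n}" for j
    unfolding f_def using lr j sj[OF j] assms(3)
    by (intro definable_fun_on_glue) (auto simp: root_parametrization_def)
  moreover have "signed_monic_poly n (\<lambda>j. a j t) = root_poly {1..n} (\<lambda>j. f j t)" if t: "t \<in> J" for t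
  proof -
    consider "t < e" | "t = e" | "t > e" by linarith
    then show ?thesis
    proof cases
      case 1
      then show ?thesis using lr(1) t by (simp add: f_def root_parametrization_def)
    next
      case 2
      then show ?thesis using Pe by (simp add: f_def)
    next
      case 3
      then have "signed_monic_poly n (\<lambda>j. a j t) = root_poly {1..n} (\<lambda>j. r j t)"
        using lr(2) t by (simp add: root_parametrization_def)
      then show ?thesis using 3 root_poly_permute[OF s, of "\<lambda>j. r j t"] by (simp add: f_def)
    qed
  qed
  moreover have "\<exists>D. (f j has_real_derivative D) (at t)" if j: "j \<in> {1..n}" and t: "t \<in> J" for j t
  proof -
    consider "t < e" | "t = e" | "t > e" by linarith
    then show ?thesis
    proof cases
      case 1
      then obtain D where "(l j has_real_derivative D) (at t)"
        using l j t unfolding differentiable_root_parametrization_def by blast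
      then have "(f j has_real_derivative D) (at t)"
        by (rule has_field_derivative_transform_within_open[of _ _ _ "{..<e}"]) (use 1 in \<open>auto simp: f_def\<close>)
      then show ?thesis ..
    next
      case 2
      have "(f j has_real_derivative L j) (at e)"
      proof (rule has_real_derivative_split)
        have fe: "f j e = v j" by (simp add: f_def)
        have "((\<lambda>t. (l j t - v j) / (t - e)) \<longlongrightarrow> L j) (at_left e)" using lim j by blast
        then show "((\<lambda>t. (f j t - f j e) / (t - e)) \<longlongrightarrow> L j) (at_left e)" unfolding fe
          by (rule Lim_transform_eventually) (use lt in \<open>eventually_elim, simp add: f_def\<close>)
        have "((\<lambda>t. (r (s j) t - v j) / (t - e)) \<longlongrightarrow> L j) (at_right e)" using lim j by blast
        then show "((\<lambda>t. (f j t - f j e) / (t - e)) \<longlongrightarrow> L j) (at_right e)" unfolding fe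
          by (rule Lim_transform_eventually) (use gt in \<open>eventually_elim, simp add: f_def\<close>)
      qed
      then show ?thesis using 2 by blast
    next
      case 3
      then obtain D where "(r (s j) has_real_derivative D) (at t)"
        using r sj[OF j] t unfolding differentiable_root_parametrization_def by blast
      then have "(f j has_real_derivative D) (at t)"
        by (rule has_field_derivative_transform_within_open[of _ _ _ "{e<..}"]) (use 3 in \<open>auto simp: f_def\<close>)
      then show ?thesis ..
    qed
  qed
  ultimately have "differentiable_root_parametrization n a J f"
    by (simp add: differentiable_root_parametrization_def root_parametrization_def)
  then show ?thesis by blast
qed

lemma Ck_on_subset: "Ck_on k f S \<Longrightarrow> T \<subseteq> S \<Longrightarrow> Ck_on k f T"
proof (induction k arbitrary: f)
  case 0
  then show ?case by (auto intro: continuous_on_subset)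
next
  case (Suc k)
  then obtain D where "\<forall>x\<in>S. (f has_real_derivative D x) (at x)" "Ck_on k D S" by auto
  then show ?case using Suc.IH[of D] Suc.prems(2) by auto
qed

text \<open>
  The ordered roots are differentiable on every open interval that avoids the finite set \<open>E\<close> of points at
  which the coincidences among them change.  Removing the points of \<open>E\<close> one at a time
  reduces the general case to gluing.
\<close>

lemma exists_differentiable_root_parametrization:
  assumes n: "2 \<le> n" and I: "open I" "is_interval I"
    and adef: "\<And>j. j \<in> {1..n} \<Longrightarrow> definable_fun_on M I (a j)"
    and a: "\<And>j. j \<in> {1..n} \<Longrightarrow> Ck_on n (a j) I"
    and hyp: "\<And>t. t \<in> I \<Longrightarrow> hyperbolic (signed_monic_poly n (\<lambda>j. a j t))"
  shows "\<exists>f. differentiable_root_parametrization n a I f"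
proof -
  have "\<exists>x. mono_on {1..n} x \<and> signed_monic_poly n (\<lambda>j. a j t) = root_poly {1..n} x" if "t \<in> I" for t
    using hyperbolic_imp_ordered_roots[OF hyp[OF that]] by (simp add: degree_signed_monic_poly)
  then obtain x where x: "\<And>t. t \<in> I \<Longrightarrow> mono_on {1..n} (x t)"
    "\<And>t. t \<in> I \<Longrightarrow> signed_monic_poly n (\<lambda>j. a j t) = root_poly {1..n} (x t)" by metis
  define l where "l j t = x t j" for j t
  have l: "signed_monic_poly n (\<lambda>j. a j t) = root_poly {1..n} (\<lambda>j. l j t)" "mono_on {1..n} (\<lambda>j. l j t)"
    if "t \<in> I" for t using x that by (simp_all add: l_def)
  have ldef: "definable_fun_on M I (l j)" if "j \<in> {1..n}" for j
    by (rule definable_ordered_roots[where a = a and n = n]) (use n adef l that in auto)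
  define E where "E = (\<Union>i\<in>{1..n}. \<Union>k\<in>{1..n}. frontier {t \<in> I. l i t = l k t})"
  have "finite E" unfolding E_def by (intro finite_UN_I finite_frontier_equalizer ldef) auto
  have "\<exists>f. differentiable_root_parametrization n a J f"
    if "finite F" "open J" "is_interval J" "J \<subseteq> I" "J \<inter> E \<subseteq> F" for F J
    using that
  proof (induction F arbitrary: J rule: finite_induct)
    case empty
    have root: "root_parametrization n a J l"
      unfolding root_parametrization_def using empty l definable_fun_on_subset[OF ldef] by auto
    have pattern: "l i t = l k t"
      if "e \<in> J" "i \<in> {1..n}" "k \<in> {1..n}" "t \<in> J" "l i e = l k e" for e i k t
    proof -
      have "J \<inter> frontier {t \<in> I. l i t = l k t} = {}" using empty that unfolding E_def by blast
      then have "J \<subseteq> {t \<in> I. l i t = l k t} \<or> J \<inter> {t \<in> I. l i t = l k t} = {}"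
        using empty by (intro connected_avoiding_frontier) (simp_all add: is_interval_connected)
      then show ?thesis using that empty by blast
    qed
    have "\<exists>D. (l j has_real_derivative D) (at e)" if "j \<in> {1..n}" "e \<in> J" for j e
      by (rule ordered_roots_differentiable[OF n empty(1,2) that(2) _ _ root _ pattern[OF that(2)] that(1)])
        (use empty a hyp l in \<open>auto intro: Ck_on_subset\<close>)
    then show ?case using root unfolding differentiable_root_parametrization_def by blast
  next
    case (insert e F)
    show ?case
    proof (cases "e \<in> J")
      case False
      then show ?thesis using insert by auto
    next
      case True
      have "\<exists>f. differentiable_root_parametrization n a (J \<inter> {..<e}) f"
        by (rule insert.IH) (use insert.prems in \<open>auto intro: is_interval_Int simp: is_interval_1\<close>)
      moreover have "\<exists>f. differentiable_root_parametrization n a (J \<inter> {e<..}) f"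
        by (rule insert.IH) (use insert.prems in \<open>auto intro: is_interval_Int simp: is_interval_1\<close>)
      moreover have "Ck_on n (a j) J" if "j \<in> {1..n}" for j
        using Ck_on_subset[OF a[OF that]] insert.prems by blast
      moreover have "hyperbolic (signed_monic_poly n (\<lambda>j. a j t))" if "t \<in> J" for t
        using hyp insert.prems that by blast
      ultimately show ?thesis
        using glue_differentiable_root_parametrizations[OF n insert.prems(1) True] by blast
    qed
  qed
  from this[OF \<open>finite E\<close> I] show ?thesis by simp
qed

end

theorem theorem6p1:
  fixes M :: "nat \<Rightarrow> real list set set"
    and I :: "real set"
    and n :: nat
    and a :: "nat \<Rightarrow> real \<Rightarrow> real"
  assumes "o_minimal_structure M"
    and "open I" and "is_interval I"
    and "\<And>j. j \<in> {1..n} \<Longrightarrow> definable_fun_on M I (a j)"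
    and "\<And>j. j \<in> {1..n} \<Longrightarrow> Ck_on n (a j) I"
    and "\<And>t. t \<in> I \<Longrightarrow> hyperbolic (signed_monic_poly n (\<lambda>j. a j t))"
  shows "\<exists>l :: nat \<Rightarrow> real \<Rightarrow> real.
    (\<forall>j\<in>{1..n}. definable_fun_on M I (l j) \<and> l j C1_differentiable_on I) \<and>
    (\<forall>t\<in>I. \<forall>x. poly (signed_monic_poly n (\<lambda>j. a j t)) x = (\<Prod>j=1..n. x - l j t))"
proof -
  interpret o_minimal_structure M by fact
  consider "n = 0" | "n = 1" | "2 \<le> n" by linarith
  then show ?thesis
  proof cases
    case 1
    then show ?thesis by (simp add: poly_signed_monic_poly)
  next
    case 2
    then have "a 1 C1_differentiable_on I" using assms(5)[of 1] Ck_on_1_iff by simp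
    then show ?thesis using 2 assms(4)[of 1] by (intro exI[of _ a]) (simp add: poly_signed_monic_poly)
  next
    case 3
    obtain l where l: "differentiable_root_parametrization n a I l"
      using exists_differentiable_root_parametrization[OF 3 assms(2-6)] by blast
    have "definable_fun_on M I (l j) \<and> l j C1_differentiable_on I" if j: "j \<in> {1..n}" for j
    proof -
      have "definable_fun_on M I (l j)" "\<forall>t\<in>I. \<exists>D. (l j has_real_derivative D) (at t)"
        using l j unfolding differentiable_root_parametrization_def root_parametrization_def by blast+
      moreover then obtain D where "\<And>t. t \<in> I \<Longrightarrow> (l j has_real_derivative D t) (at t)" by metis
      ultimately show ?thesis using definable_differentiable_imp_C1[OF assms(2)] by blast
    qed
    moreover have "poly (signed_monic_poly n (\<lambda>j. a j t)) x = (\<Prod>j=1..n. x - l j t)" if "t \<in> I" for t x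
      using l that by (simp add: differentiable_root_parametrization_def root_parametrization_def poly_root_poly)
    ultimately show ?thesis by blast
  qed
qed

end
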